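(* Let $\Gamma$ be a compact and connected metric graph endowed with a metric $d(\cdot,\cdot)$ that satisfies the intermediate value property, is regular, and is connected on $\Gamma$ (as defined in the context). Let $u$ be a Gaussian random field on $\Gamma$ that is Markov of order 1 and has a continuous, strictly positive definite covariance function $r:\Gamma\times\Gamma\to\mathbb{R}$. Let $\mathcal{P}\subset\Gamma$ be an admissible set of points for $\Gamma$. Then the distribution of the Gaussian vector $\{u(s): s\in\mathcal{P}\}$ is MTP$_2$.
   Context: **Metric graphs.** A compact metric graph $\Gamma$ consists of finitely many vertices $\mathcal{V}$ and finitely many edges $\mathcal{E}$; each edge $e$ is a rectifiable curve of finite length $l_e\in(0,\infty)$, parameterized by arc length (identified with $[0,l_e]$), connecting a pair of vertices. Points of $\Gamma$ are written $s=(t,e)$ with $t\in[0,l_e]$. All topological notions on $\Gamma$ (open sets, closure $\overline S$, boundary $\partial S$, continuity of functions) refer to the geodesic (shortest path) metric $d_{\mathrm{geo}}$ on $\Gamma$; the metric $d$ in the claim need not be the geodesic one. **Paths.** A path on $\Gamma$ connecting $s_1,s_2\in\Gamma$ is a union $f_1\cup e_2\cup\dots\cup e_{n-1}\cup f_n$, where $e_1,\dots,e_n\in\mathcal{E}$, consecutive edges share an endpoint (through which the path passes), $f_1$ is the part of $e_1$ from $s_1$ to one of the endpoints of $e_1$, and $f_n$ is the part of $e_n$ from one of its endpoints to $s_2$ (a segment of a single edge is also a path). A path is simple if it has no self-intersections (each vertex in it belongs to at most two of its edges, and it contains no loops). **Conditions on $d$.** (i) $d$ satisfies the intermediate value property if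 for every $e\in\mathcal{E}$, all $t,t_1,t_2\in e$ and $\tau>0$ with $d(t,t_1)>\tau$ and $d(t,t_2)<\tau$, there exists $t^*\in e$ with $d(t,t^* )=\tau$. (ii) Let $d$ satisfy the intermediate value property. Given $t,s\in\Gamma$, a simple path $P_{t,s}$ between $t$ and $s$, and $0<\tau<d(t,s)$, consider a sequence of points of $P_{t,s}$: $p_0=s$; $p_1\in P_{t,s}$ with $d(p_1,s)=\tau$; $p_2\in P_{t,p_1}\subset P_{t,s}$ with $d(p_1,p_2)=\tau$; and, for $k>1$, $p_k\in P_{t,p_{k-1}}\subset P_{t,p_{k-2}}$ with $d(p_k,p_{k-1})=\tau$, where $P_{t,p}$ denotes the sub-path of $P_{t,s}$ between $t$ and $p$; the sequence continues as long as such a point exists. $d$ is regular if for all such $t,s,\tau$ this sequence is finite and its last term $p_{N}$ satisfies $d(t,p_{N})<\tau$. (iii) $d$ is connected on $\Gamma$ if all simple paths on $\Gamma$ are connected subsets of the metric space $(\Gamma,d)$. **Admissible points.** Let $\mathcal{P}\subset\Gamma$ be a finite set with $\mathcal{P}\supset\mathcal{V}$. $\Gamma_{\mathcal{P}}=(\mathcal{P},\mathcal{E}_{\mathcal{P}})$ is the combinatorial graph obtained by turning all points of $\mathcal{P}$ into vertices: $\mathcal{E}_{\mathcal{P}}$ contains each edge of $\mathcal{E}$ having no point of $\mathcal{P}$ in its interior, and each other edge of $\mathcal{E}$ is replaced by the subintervals into which the points of $\mathcal{P}$ split it. $\mathcal{P}$ is admissible for $\Gamma$ if $\Gamma_{\mathcal{P}}$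 has no multiple edges, i.e. there is at most one edge between any pair of vertices of $\Gamma_{\mathcal{P}}$. **Markov of order 1.** For a random field $u$ on $\Gamma$ (on a complete probability space) and $S\subset\Gamma$, let $\mathcal{F}^u(S)=\sigma(u(s):s\in S)$ and $\mathcal{F}^u_+(S)=\bigcap_{\varepsilon>0}\mathcal{F}^u(S_\varepsilon)$, with $S_\varepsilon=\{s\in\Gamma:\exists z\in S,\ d_{\mathrm{geo}}(s,z)<\varepsilon\}$. A $\sigma$-algebra $\mathcal{C}$ splits $\mathcal{A}$ and $\mathcal{B}$ if $\mathcal{A}$ and $\mathcal{B}$ are conditionally independent given $\mathcal{C}$. A Gaussian random field $u$ is Markov of order 1 if it is continuous in $L_2(\Omega)$ and, for every open $S\subset\Gamma$, $\sigma(u(s):s\in\partial S)$ splits $\mathcal{F}^u_+(\overline S)$ and $\mathcal{F}^u_+(\Gamma\setminus S)$. **Strict positive definiteness.** The matrix $(r(x_i,x_j))_{i,j}$ is positive definite for every finite set of distinct points $x_i\in\Gamma$. **MTP$_2$.** A Gaussian vector indexed by a finite nonempty set $S$ with invertible covariance matrix $\Sigma$ and precision matrix $Q=\Sigma^{-1}=[Q_{ts}]_{t,s\in S}$ has an MTP$_2$ distribution if $Q_{ss}>0$ for all $s\in S$ and $Q_{st}\le 0$ for all $s\ne t$ in $S$. *)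

theory Defs
  imports "HOL-Probability.Probability"
begin

section \<open>Compact metric graphs\<close>

text \<open>
  The edge \<open>e\<close> is the curve \<open>\<lambda>t. pt G e t\<close> on \<open>{0..len G e}\<close>. Loops and parallel edges are
  allowed. The conditions below say that the point set of the graph is the disjoint union of the
  intervals \<open>{0..len G e}\<close> and the vertices, glued at the endpoints of the intervals and
  nowhere else.
\<close>

record ('a, 'e) metric_graph =
  verts :: "'a set"
  edges :: "'e set"
  len :: "'e \<Rightarrow> real"
  pt :: "'e \<Rightarrow> real \<Rightarrow> 'a"

locale compact_metric_graph =
  fixes G :: "('a, 'e) metric_graph" (structure)
  assumes finite_verts: "finite (verts G)"
    and nonempty_verts: "verts G \<noteq> {}"
    and finite_edges: "finite (edges G)"
    and len_pos: "e \<in> edges G \<Longrightarrow> 0 < len G e"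
    and start_in_verts: "e \<in> edges G \<Longrightarrow> pt G e 0 \<in> verts G"
    and end_in_verts: "e \<in> edges G \<Longrightarrow> pt G e (len G e) \<in> verts G"
    and inner_notin_verts: "e \<in> edges G \<Longrightarrow> 0 < t \<Longrightarrow> t < len G e \<Longrightarrow> pt G e t \<notin> verts G"
    and inner_inj: "e \<in> edges G \<Longrightarrow> 0 < t \<Longrightarrow> t < len G e \<Longrightarrow>
       e' \<in> edges G \<Longrightarrow> 0 < t' \<Longrightarrow> t' < len G e' \<Longrightarrow> pt G e t = pt G e' t' \<Longrightarrow> e = e' \<and> t = t'"

definition edge_points :: "('a, 'e) metric_graph \<Rightarrow> 'e \<Rightarrow> 'a set" where
  "edge_points G e = pt G e ` {0..len G e}"

definition points :: "('a, 'e) metric_graph \<Rightarrow> 'a set" where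
  "points G = verts G \<union> (\<Union>e\<in>edges G. edge_points G e)"


section \<open>Paths and the geodesic metric\<close>

text \<open>\<open>Seg e a b\<close> is the part of \<open>e\<close> between the parameters \<open>a\<close> and \<open>b\<close>, traversed from \<open>a\<close> to \<open>b\<close>.\<close>

datatype 'e segment = Seg (seg_edge: 'e) (seg_from: real) (seg_to: real)

definition seg_points :: "('a, 'e) metric_graph \<Rightarrow> 'e segment \<Rightarrow> 'a set" where
  "seg_points G f = pt G (seg_edge f) ` closed_segment (seg_from f) (seg_to f)"

definition seg_start :: "('a, 'e) metric_graph \<Rightarrow> 'e segment \<Rightarrow> 'a" where
  "seg_start G f = pt G (seg_edge f) (seg_from f)"

definition seg_end :: "('a, 'e) metric_graph \<Rightarrow> 'e segment \<Rightarrow> 'a" where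
  "seg_end G f = pt G (seg_edge f) (seg_to f)"

text \<open>
  A segment that is not the last one leaves through an endpoint of its edge, one that is not the
  first one enters through an endpoint, and one that is neither covers its whole edge. The empty
  list is the constant path; it is needed only when the graph is a single vertex.
\<close>

definition graph_path :: "('a, 'e) metric_graph \<Rightarrow> 'a \<Rightarrow> 'e segment list \<Rightarrow> 'a \<Rightarrow> bool" where
  "graph_path G s fs t \<longleftrightarrow>
     s \<in> points G \<and> t \<in> points G \<and>
     (if fs = [] then s = t else seg_start G (hd fs) = s \<and> seg_end G (last fs) = t) \<and>
     (\<forall>f\<in>set fs. seg_edge f \<in> edges G \<and>
        seg_from f \<in> {0..len G (seg_edge f)} \<and> seg_to f \<in> {0..len G (seg_edge f)}) \<and>
     (\<forall>i. Suc i < length fs \<longrightarrow>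
        seg_to (fs ! i) \<in> {0, len G (seg_edge (fs ! i))} \<and>
        seg_from (fs ! Suc i) \<in> {0, len G (seg_edge (fs ! Suc i))} \<and>
        seg_end G (fs ! i) = seg_start G (fs ! Suc i)) \<and>
     (\<forall>i. 0 < i \<and> Suc i < length fs \<longrightarrow> seg_from (fs ! i) \<noteq> seg_to (fs ! i))"

definition path_points :: "('a, 'e) metric_graph \<Rightarrow> 'a \<Rightarrow> 'e segment list \<Rightarrow> 'a set" where
  "path_points G s fs = insert s (\<Union>f\<in>set fs. seg_points G f)"

definition path_length :: "'e segment list \<Rightarrow> real" where
  "path_length fs = (\<Sum>f\<leftarrow>fs. \<bar>seg_to f - seg_from f\<bar>)"

definition simple_path :: "('a, 'e) metric_graph \<Rightarrow> 'a \<Rightarrow> 'e segment list \<Rightarrow> 'a \<Rightarrow> bool" where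
  "simple_path G s fs t \<longleftrightarrow>
     graph_path G s fs t \<and>
     (\<forall>f\<in>set fs. inj_on (pt G (seg_edge f)) (closed_segment (seg_from f) (seg_to f))) \<and>
     (\<forall>i j. i < j \<and> j < length fs \<longrightarrow>
        seg_points G (fs ! i) \<inter> seg_points G (fs ! j) \<subseteq> (if j = Suc i then {seg_end G (fs ! i)} else {}))"

definition connected_graph :: "('a, 'e) metric_graph \<Rightarrow> bool" where
  "connected_graph G \<longleftrightarrow> (\<forall>s\<in>points G. \<forall>t\<in>points G. \<exists>fs. graph_path G s fs t)"

text \<open>The value outside of the graph is irrelevant; 0 makes it fit \<^locale>\<open>Metric_space\<close>.\<close>

definition geo_dist :: "('a, 'e) metric_graph \<Rightarrow> 'a \<Rightarrow> 'a \<Rightarrow> real" where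
  "geo_dist G s t =
     (if s \<in> points G \<and> t \<in> points G then Inf {path_length fs | fs. graph_path G s fs t} else 0)"

definition geo_topology :: "('a, 'e) metric_graph \<Rightarrow> 'a topology" where
  "geo_topology G = Metric_space.mtopology (points G) (geo_dist G)"


section \<open>Conditions on a further metric\<close>

definition intermediate_value_property ::
  "('a, 'e) metric_graph \<Rightarrow> ('a \<Rightarrow> 'a \<Rightarrow> real) \<Rightarrow> bool" where
  "intermediate_value_property G d \<longleftrightarrow>
     (\<forall>e\<in>edges G. \<forall>t\<in>edge_points G e. \<forall>t1\<in>edge_points G e. \<forall>t2\<in>edge_points G e. \<forall>\<tau>>0.
        d t t1 > \<tau> \<and> d t t2 < \<tau> \<longrightarrow> (\<exists>t'\<in>edge_points G e. d t t' = \<tau>))"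

definition initial_subpath :: "'e segment list \<Rightarrow> 'e segment list \<Rightarrow> bool" where
  "initial_subpath fs gs \<longleftrightarrow>
     gs = [] \<or>
     (\<exists>i<length fs. \<exists>c\<in>closed_segment (seg_from (fs ! i)) (seg_to (fs ! i)).
        gs = take i fs @ [Seg (seg_edge (fs ! i)) (seg_from (fs ! i)) c])"

text \<open>
  The sub-path between \<open>t\<close> and \<open>p\<close> of a simple path \<open>fs\<close> that starts in \<open>t\<close>. All initial sub-paths
  ending in \<open>p\<close> have the same points, so that the union selects just one set.
\<close>

definition subpath_points ::
  "('a, 'e) metric_graph \<Rightarrow> 'a \<Rightarrow> 'e segment list \<Rightarrow> 'a \<Rightarrow> 'a set" where
  "subpath_points G t fs p = \<Union>{path_points G t gs | gs. initial_subpath fs gs \<and> graph_path G t gs p}"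

definition next_points ::
  "('a, 'e) metric_graph \<Rightarrow> ('a \<Rightarrow> 'a \<Rightarrow> real) \<Rightarrow> 'a \<Rightarrow> 'e segment list \<Rightarrow> real \<Rightarrow> 'a \<Rightarrow> 'a set" where
  "next_points G d t fs \<tau> p = {q \<in> subpath_points G t fs p. d q p = \<tau>}"

text \<open>
  The points \<open>p k\<close> are in general not unique; the condition is imposed on every choice of the
  sequence. The first conjunct says that the sequence stops, the second one is about the last
  term of a sequence that cannot be continued.
\<close>

definition regular_metric :: "('a, 'e) metric_graph \<Rightarrow> ('a \<Rightarrow> 'a \<Rightarrow> real) \<Rightarrow> bool" where
  "regular_metric G d \<longleftrightarrow>
     (\<forall>t\<in>points G. \<forall>s\<in>points G. \<forall>fs \<tau>. simple_path G t fs s \<and> 0 < \<tau> \<and> \<tau> < d t s \<longrightarrow>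
        \<not> (\<exists>p. p 0 = s \<and> (\<forall>k. p (Suc k) \<in> next_points G d t fs \<tau> (p k))) \<and>
        (\<forall>p (N::nat). p 0 = s \<and> (\<forall>k<N. p (Suc k) \<in> next_points G d t fs \<tau> (p k)) \<and>
           next_points G d t fs \<tau> (p N) = {} \<longrightarrow> d t (p N) < \<tau>))"

definition connected_metric :: "('a, 'e) metric_graph \<Rightarrow> ('a \<Rightarrow> 'a \<Rightarrow> real) \<Rightarrow> bool" where
  "connected_metric G d \<longleftrightarrow>
     (\<forall>s fs t. simple_path G s fs t \<longrightarrow>
        connectedin (Metric_space.mtopology (points G) d) (path_points G s fs))"


section \<open>Admissible points\<close>

text \<open>
  \<open>(e, a, b)\<close> stands for the part of \<open>e\<close> between \<open>a\<close> and \<open>b\<close>. Since the vertices of the graph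
  belong to \<open>P\<close>, this includes the case of a whole edge without points of \<open>P\<close> in its interior.
  Only pairs of distinct vertices are considered: loops of the subdivision are not restricted.
\<close>

definition subdivision_edges :: "('a, 'e) metric_graph \<Rightarrow> 'a set \<Rightarrow> ('e \<times> real \<times> real) set" where
  "subdivision_edges G P =
     {(e, a, b). e \<in> edges G \<and> 0 \<le> a \<and> a < b \<and> b \<le> len G e \<and> pt G e a \<in> P \<and> pt G e b \<in> P \<and>
        (\<forall>c. a < c \<and> c < b \<longrightarrow> pt G e c \<notin> P)}"

definition subdivision_ends :: "('a, 'e) metric_graph \<Rightarrow> 'e \<times> real \<times> real \<Rightarrow> 'a set" where
  "subdivision_ends G = (\<lambda>(e, a, b). {pt G e a, pt G e b})"

definition admissible :: "('a, 'e) metric_graph \<Rightarrow> 'a set \<Rightarrow> bool" where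
  "admissible G P \<longleftrightarrow>
     finite P \<and> verts G \<subseteq> P \<and> P \<subseteq> points G \<and>
     (\<forall>x\<in>P. \<forall>y\<in>P. x \<noteq> y \<longrightarrow>
        (\<forall>h\<in>subdivision_edges G P. \<forall>h'\<in>subdivision_edges G P.
           subdivision_ends G h = {x, y} \<and> subdivision_ends G h' = {x, y} \<longrightarrow> h = h'))"


section \<open>Gaussian random fields\<close>

text \<open>Constants count as (degenerate) Gaussian random variables.\<close>

definition gaussian_rv :: "'w measure \<Rightarrow> ('w \<Rightarrow> real) \<Rightarrow> bool" where
  "gaussian_rv M X \<longleftrightarrow>
     X \<in> borel_measurable M \<and>
     ((\<exists>m. AE \<omega> in M. X \<omega> = m) \<or>
      (\<exists>m \<sigma>. 0 < \<sigma> \<and> distributed M lborel X (\<lambda>x. ennreal (normal_density m \<sigma> x))))"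

definition gaussian_field :: "'w measure \<Rightarrow> 'a set \<Rightarrow> ('a \<Rightarrow> 'w \<Rightarrow> real) \<Rightarrow> bool" where
  "gaussian_field M S u \<longleftrightarrow>
     (\<forall>F c. finite F \<and> F \<subseteq> S \<longrightarrow> gaussian_rv M (\<lambda>\<omega>. \<Sum>s\<in>F. c s * u s \<omega>))"

definition covariance :: "'w measure \<Rightarrow> ('w \<Rightarrow> real) \<Rightarrow> ('w \<Rightarrow> real) \<Rightarrow> real" where
  "covariance M X Y =
     (\<integral>\<omega>. (X \<omega> - (\<integral>\<omega>'. X \<omega>' \<partial>M)) * (Y \<omega> - (\<integral>\<omega>'. Y \<omega>' \<partial>M)) \<partial>M)"

definition strictly_pos_def_on :: "'a set \<Rightarrow> ('a \<Rightarrow> 'a \<Rightarrow> real) \<Rightarrow> bool" where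
  "strictly_pos_def_on S r \<longleftrightarrow>
     (\<forall>s\<in>S. \<forall>t\<in>S. r s t = r t s) \<and>
     (\<forall>F c. finite F \<and> F \<subseteq> S \<and> (\<exists>s\<in>F. c s \<noteq> 0) \<longrightarrow> 0 < (\<Sum>s\<in>F. \<Sum>t\<in>F. c s * r s t * c t))"


section \<open>Markov random fields of order 1\<close>

definition field_sigma :: "'w measure \<Rightarrow> ('a \<Rightarrow> 'w \<Rightarrow> real) \<Rightarrow> 'a set \<Rightarrow> 'w set set" where
  "field_sigma M u S = sigma_sets (space M) {u s -` B \<inter> space M | s B. s \<in> S \<and> B \<in> sets borel}"

definition geo_nbhd :: "('a, 'e) metric_graph \<Rightarrow> 'a set \<Rightarrow> real \<Rightarrow> 'a set" where
  "geo_nbhd G S \<epsilon> = {s \<in> points G. \<exists>z\<in>S. geo_dist G s z < \<epsilon>}"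

definition field_sigma_plus ::
  "('a, 'e) metric_graph \<Rightarrow> 'w measure \<Rightarrow> ('a \<Rightarrow> 'w \<Rightarrow> real) \<Rightarrow> 'a set \<Rightarrow> 'w set set" where
  "field_sigma_plus G M u S = (\<Inter>\<epsilon>\<in>{0<..}. field_sigma M u (geo_nbhd G S \<epsilon>))"

definition splits :: "'w measure \<Rightarrow> 'w set set \<Rightarrow> 'w set set \<Rightarrow> 'w set set \<Rightarrow> bool" where
  "splits M C A B \<longleftrightarrow>
     (\<forall>a\<in>A. \<forall>b\<in>B. AE \<omega> in M.
        real_cond_exp M (sigma (space M) C) (indicator (a \<inter> b)) \<omega> =
        real_cond_exp M (sigma (space M) C) (indicator a) \<omega> *
        real_cond_exp M (sigma (space M) C) (indicator b) \<omega>)"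

definition L2_continuous ::
  "('a, 'e) metric_graph \<Rightarrow> 'w measure \<Rightarrow> ('a \<Rightarrow> 'w \<Rightarrow> real) \<Rightarrow> bool" where
  "L2_continuous G M u \<longleftrightarrow>
     (\<forall>s\<in>points G. u s \<in> borel_measurable M \<and> integrable M (\<lambda>\<omega>. (u s \<omega>)\<^sup>2) \<and>
        ((\<lambda>t. \<integral>\<omega>. (u t \<omega> - u s \<omega>)\<^sup>2 \<partial>M) \<longlongrightarrow> 0) (atin (geo_topology G) s))"

definition markov_order_1 ::
  "('a, 'e) metric_graph \<Rightarrow> 'w measure \<Rightarrow> ('a \<Rightarrow> 'w \<Rightarrow> real) \<Rightarrow> bool" where
  "markov_order_1 G M u \<longleftrightarrow>
     L2_continuous G M u \<and>
     (\<forall>S. openin (geo_topology G) S \<longrightarrow>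
        splits M (field_sigma M u (geo_topology G frontier_of S))
          (field_sigma_plus G M u (geo_topology G closure_of S))
          (field_sigma_plus G M u (points G - S)))"


section \<open>Gaussian MTP2 vectors\<close>

text \<open>Matrices indexed by a finite set \<open>S\<close> are functions of which only the values on \<open>S\<close> count.\<close>

definition inverse_matrix_on :: "'a set \<Rightarrow> ('a \<Rightarrow> 'a \<Rightarrow> real) \<Rightarrow> ('a \<Rightarrow> 'a \<Rightarrow> real) \<Rightarrow> bool" where
  "inverse_matrix_on S A Q \<longleftrightarrow>
     (\<forall>s\<in>S. \<forall>t\<in>S. (\<Sum>k\<in>S. A s k * Q k t) = (if s = t then 1 else 0) \<and>
                   (\<Sum>k\<in>S. Q s k * A k t) = (if s = t then 1 else 0))"

definition gaussian_mtp2 :: "'w measure \<Rightarrow> 'a set \<Rightarrow> ('a \<Rightarrow> 'w \<Rightarrow> real) \<Rightarrow> bool" where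
  "gaussian_mtp2 M S X \<longleftrightarrow>
     finite S \<and> S \<noteq> {} \<and> gaussian_field M S X \<and>
     (\<exists>Q. inverse_matrix_on S (\<lambda>s t. covariance M (X s) (X t)) Q \<and>
        (\<forall>s\<in>S. 0 < Q s s) \<and> (\<forall>s\<in>S. \<forall>t\<in>S. s \<noteq> t \<longrightarrow> Q s t \<le> 0))"

end

theory Submission
  imports Defs
begin

text \<open>
  Let \<open>Q\<close> be the inverse of the covariance matrix of the vector \<open>(u s)\<close>, \<open>s \<in> P\<close>. Its diagonal is
  positive because \<open>Q\<close> is positive definite. For \<open>s \<noteq> t\<close> in \<open>P\<close>, the entry \<open>Q s t\<close> is, up to a
  negative factor, the covariance of \<open>u s\<close> and \<open>u t\<close> conditional on the rest of \<open>P\<close>, and the claim is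
  that this covariance is not negative.

  The reason is an intermediate value argument. Let \<open>X\<close> be the residual of \<open>u s\<close>
  after projection onto the \<open>u y\<close> with \<open>y \<in> P - {s, t}\<close>, scaled by a positive factor, and let \<open>c q\<close>
  be the covariance of \<open>X\<close> and \<open>u q\<close>. This function is continuous on the graph, vanishes on \<open>P - {s, t}\<close> and
  is positive in \<open>s\<close>. Suppose that it is negative in \<open>t\<close>. The open set \<open>S\<close> where \<open>c > 0\<close> contains
  \<open>s\<close> but not \<open>t\<close>, and \<open>c = 0\<close> on its boundary. By the Markov property, the values of the field outside
  of \<open>S\<close> tell no more about \<open>u s\<close> than those on the boundary of \<open>S\<close>. Hence the conditional expectation
  of the centred \<open>X\<close>, given the field outside of \<open>S\<close>, depends only on the field on the boundary of
  \<open>S\<close> and on \<open>P - {s, t}\<close>. But \<open>X\<close> is uncorrelated with the field on those points and therefore, the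
  field being Gaussian, has conditional mean zero given them. So the conditional expectation of the
  centred \<open>X\<close> given the field outside of \<open>S\<close> is zero, and \<open>c t = 0\<close> because \<open>t\<close> lies outside of
  \<open>S\<close>: a contradiction. This step is \<open>covariance_zero_beyond_splitting_set\<close>.

  The boundary of \<open>S\<close> may be infinite, so that no linear algebra on finitely many points is
  available. The statement that a Gaussian variable has conditional mean zero given a family of
  variables uncorrelated with it is obtained from Fourier transforms instead. The characteristic
  function of \<open>a X + Y\<close>, differentiated in \<open>a = 0\<close>, shows that the expectation of \<open>X exp (\<i> Y)\<close> is zero for
  centred \<open>X\<close> and every linear combination \<open>Y\<close> of the family. The uniqueness theorem for characteristic
  functions, used for one variable at a time, turns this into the vanishing of the integral of \<open>X\<close>
  over every event generated by the family (\<open>uncorrelated_imp_set_integral_zero\<close>).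
\<close>


section \<open>From Fourier transforms to integrals\<close>

text \<open>
  The positive and the negative part of \<open>W\<close> have the same total mass. If it is zero, \<open>W\<close> vanishes almost everywhere;
  otherwise both become probability densities after division by it. The two laws of \<open>Z\<close> under these densities have the same
  characteristic function, hence agree by Levy's uniqueness theorem.
\<close>

lemma real_fourier_zero_imp_integral_zero:
  fixes W Z :: "'w \<Rightarrow> real"
  assumes [measurable]: "integrable M W" "Z \<in> borel_measurable M" "A \<in> sets borel"
    and zero: "\<And>l. (\<integral>\<omega>. complex_of_real (W \<omega>) * iexp (l * Z \<omega>) \<partial>M) = 0"
  shows "(\<integral>\<omega>. W \<omega> * indicator A (Z \<omega>) \<partial>M) = 0"
proof -
  have [measurable]: "W \<in> borel_measurable M" using assms(1) by simp
  define p where "p \<omega> = max 0 (W \<omega>)" for \<omega>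
  define n where "n \<omega> = max 0 (- W \<omega>)" for \<omega>
  have [measurable]: "p \<in> borel_measurable M" "n \<in> borel_measurable M"
    by (auto simp: p_def[abs_def] n_def[abs_def])
  have int: "integrable M p" "integrable M n"
    using assms(1) by (auto simp: p_def[abs_def] n_def[abs_def])
  have W: "W \<omega> = p \<omega> - n \<omega>" for \<omega> by (auto simp: p_def n_def)
  have nonneg: "0 \<le> p \<omega>" "0 \<le> n \<omega>" for \<omega> by (auto simp: p_def n_def)
  have int_mult: "integrable M (\<lambda>\<omega>. complex_of_real (f \<omega>) * iexp (l * Z \<omega>))"
    if "integrable M f" for f l
    by (rule Bochner_Integration.integrable_bound[OF that])
       (use that in \<open>auto simp: norm_mult\<close>)
  have pn: "(\<integral>\<omega>. complex_of_real (p \<omega>) * iexp (l * Z \<omega>) \<partial>M) =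
      (\<integral>\<omega>. complex_of_real (n \<omega>) * iexp (l * Z \<omega>) \<partial>M)" for l
    using zero[of l] int_mult[OF int(1), of l] int_mult[OF int(2), of l]
    by (simp add: W left_diff_distrib)
  define m where "m = (\<integral>\<omega>. p \<omega> \<partial>M)"
  have m: "(\<integral>\<omega>. n \<omega> \<partial>M) = m"
    using pn[of 0] by (simp add: m_def)
  have "m \<ge> 0" by (simp add: m_def nonneg)
  show ?thesis
  proof (cases "m = 0")
    case True
    then have "AE \<omega> in M. p \<omega> = 0" "AE \<omega> in M. n \<omega> = 0"
      using integral_nonneg_eq_0_iff_AE[OF int(1)] integral_nonneg_eq_0_iff_AE[OF int(2)] nonneg m
      by (auto simp: m_def)
    then have "AE \<omega> in M. W \<omega> * indicator A (Z \<omega>) = 0" by eventually_elim (simp add: W)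
    then show ?thesis by (rule integral_eq_zero_AE)
  next
    case False
    with \<open>m \<ge> 0\<close> have "m > 0" by simp
    define D where "D f = distr (density M (\<lambda>\<omega>. ennreal (f \<omega> / m))) borel Z" for f
    have D: "real_distribution (D f)"
      "char (D f) = (\<lambda>l. (\<integral>\<omega>. complex_of_real (f \<omega>) * iexp (l * Z \<omega>) \<partial>M) / m)"
      "measure (D f) A = (\<integral>\<omega>. f \<omega> * indicator A (Z \<omega>) \<partial>M) / m"
      if f: "integrable M f" "\<And>\<omega>. 0 \<le> f \<omega>" "(\<integral>\<omega>. f \<omega> \<partial>M) = m" for f
    proof -
      have [measurable]: "f \<in> borel_measurable M" using f by simp
      have "emeasure (density M (\<lambda>\<omega>. ennreal (f \<omega> / m))) (space M) = 1"
        using f \<open>m > 0\<close> by (subst emeasure_density) (auto simp: nn_integral_eq_integral cong: nn_integral_cong)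
      then have "prob_space (density M (\<lambda>\<omega>. ennreal (f \<omega> / m)))"
        by (intro prob_spaceI) simp
      then show "real_distribution (D f)"
        unfolding D_def by (intro prob_space.real_distribution_distr) auto
      show "char (D f) = (\<lambda>l. (\<integral>\<omega>. complex_of_real (f \<omega>) * iexp (l * Z \<omega>) \<partial>M) / m)"
        using f \<open>m > 0\<close>
        by (simp add: D_def char_def integral_distr integral_density scaleR_conv_of_real fun_eq_iff)
      have "measure (D f) A = (\<integral>x. indicator A x \<partial>D f)"
        by (simp add: D_def)
      also have "\<dots> = (\<integral>\<omega>. indicator A (Z \<omega>) \<partial>density M (\<lambda>\<omega>. ennreal (f \<omega> / m)))"
        unfolding D_def by (rule integral_distr) auto
      also have "\<dots> = (\<integral>\<omega>. (f \<omega> / m) *\<^sub>R indicator A (Z \<omega>) \<partial>M)"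
        using f \<open>m > 0\<close> by (intro integral_density) auto
      also have "\<dots> = (\<integral>\<omega>. f \<omega> * indicator A (Z \<omega>) \<partial>M) / m"
        by simp
      finally show "measure (D f) A = (\<integral>\<omega>. f \<omega> * indicator A (Z \<omega>) \<partial>M) / m" .
    qed
    have "D p = D n"
      using D[OF int(1) nonneg(1) m_def[symmetric]] D[OF int(2) nonneg(2) m] pn
      by (intro Levy_uniqueness) auto
    with D(3)[OF int(1) nonneg(1) m_def[symmetric]] D(3)[OF int(2) nonneg(2) m] \<open>m > 0\<close>
    have eq: "(\<integral>\<omega>. p \<omega> * indicator A (Z \<omega>) \<partial>M) = (\<integral>\<omega>. n \<omega> * indicator A (Z \<omega>) \<partial>M)"
      by simp
    have "integrable M (\<lambda>\<omega>. f \<omega> * indicator A (Z \<omega>))" if "integrable M f" for f :: "'w \<Rightarrow> real"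
      by (rule Bochner_Integration.integrable_bound[OF that])
         (use that in \<open>auto split: split_indicator\<close>)
    with int eq show ?thesis by (simp add: W left_diff_distrib)
  qed
qed

lemma integrable_mult_bounded:
  fixes W g :: "'w \<Rightarrow> complex"
  assumes "integrable M W" "g \<in> borel_measurable M" "\<And>\<omega>. norm (g \<omega>) \<le> 1"
  shows "integrable M (\<lambda>\<omega>. W \<omega> * g \<omega>)"
  by (rule Bochner_Integration.integrable_bound[OF assms(1)])
     (use assms in \<open>auto simp: norm_mult intro!: mult_left_le\<close>)

text \<open>
  Replacing \<open>l\<close> by \<open>- l\<close> and conjugating shows that the hypothesis passes from \<open>W\<close> to its real and
  imaginary parts. Complex densities are needed because the induction over several variables below
  absorbs the exponentials of the remaining variables into \<open>W\<close>.
\<close>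

lemma fourier_zero_imp_integral_zero:
  fixes W :: "'w \<Rightarrow> complex" and Z :: "'w \<Rightarrow> real"
  assumes W: "integrable M W" and [measurable]: "Z \<in> borel_measurable M" "A \<in> sets borel"
    and zero: "\<And>l. (\<integral>\<omega>. W \<omega> * iexp (l * Z \<omega>) \<partial>M) = 0"
  shows "(\<integral>\<omega>. W \<omega> * indicator A (Z \<omega>) \<partial>M) = 0"
proof -
  have [measurable]: "W \<in> borel_measurable M" using W by simp
  have Re: "(\<integral>\<omega>. Re (W \<omega>) * indicator A (Z \<omega>) \<partial>M) = 0"
    if W: "integrable M W" and zero: "\<And>l. (\<integral>\<omega>. W \<omega> * iexp (l * Z \<omega>) \<partial>M) = 0"
    for W :: "'w \<Rightarrow> complex"
  proof (rule real_fourier_zero_imp_integral_zero)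
    fix l
    have int: "integrable M (\<lambda>\<omega>. W \<omega> * iexp (l * Z \<omega>))" for l
      by (rule integrable_mult_bounded[OF W]) auto
    have "(\<integral>\<omega>. complex_of_real (Re (W \<omega>)) * iexp (l * Z \<omega>) \<partial>M) =
        (\<integral>\<omega>. (W \<omega> * iexp (l * Z \<omega>) + cnj (W \<omega> * iexp (- l * Z \<omega>))) / 2 \<partial>M)"
    proof (intro Bochner_Integration.integral_cong refl)
      fix \<omega>
      have "cnj (W \<omega> * iexp (- l * Z \<omega>)) = cnj (W \<omega>) * iexp (l * Z \<omega>)"
        by (simp add: exp_cnj)
      moreover have "complex_of_real (Re (W \<omega>)) = (W \<omega> + cnj (W \<omega>)) / 2"
        by (simp add: complex_add_cnj)
      ultimately show "complex_of_real (Re (W \<omega>)) * iexp (l * Z \<omega>) =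
          (W \<omega> * iexp (l * Z \<omega>) + cnj (W \<omega> * iexp (- l * Z \<omega>))) / 2"
        by (simp only: distrib_right times_divide_eq_left)
    qed
    also have "\<dots> = ((\<integral>\<omega>. W \<omega> * iexp (l * Z \<omega>) \<partial>M) + cnj (\<integral>\<omega>. W \<omega> * iexp (- l * Z \<omega>) \<partial>M)) / 2"
      using int[of l] int[of "- l"]
      by (simp add: integral_cnj[symmetric] del: complex_cnj_mult integral_cnj)
    finally show "(\<integral>\<omega>. complex_of_real (Re (W \<omega>)) * iexp (l * Z \<omega>) \<partial>M) = 0"
      using zero[of l] zero[of "- l"] by simp
  qed (use W in auto)
  have "(\<integral>\<omega>. - \<i> * W \<omega> * iexp (l * Z \<omega>) \<partial>M) = 0" for l
    using zero[of l] by (simp add: mult.assoc)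
  with Re[of "\<lambda>\<omega>. - \<i> * W \<omega>"] W have Im: "(\<integral>\<omega>. Im (W \<omega>) * indicator A (Z \<omega>) \<partial>M) = 0"
    by simp
  have int: "integrable M (\<lambda>\<omega>. W \<omega> * indicator A (Z \<omega>))"
    by (rule integrable_mult_bounded[OF W]) (auto split: split_indicator)
  have ind: "indicator A z = complex_of_real (indicator A z)" for z :: real
    by (auto split: split_indicator)
  show ?thesis
  proof (rule complex_eqI)
    show "Re (\<integral>\<omega>. W \<omega> * indicator A (Z \<omega>) \<partial>M) = Re 0"
      using Re[OF W zero] integral_Re[OF int] by (simp add: ind)
    show "Im (\<integral>\<omega>. W \<omega> * indicator A (Z \<omega>) \<partial>M) = Im 0"
      using Im integral_Im[OF int] by (simp add: ind)
  qed
qed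

text \<open>
  A multivariate uniqueness theorem, reduced to the one-dimensional one: the exponential of one
  variable after the other is replaced by an indicator function, while everything else counts as the
  density.
\<close>

lemma finite_fourier_zero_imp_integral_zero:
  fixes W :: "'w \<Rightarrow> complex" and Z :: "'a \<Rightarrow> 'w \<Rightarrow> real"
  assumes "finite J" "integrable M W"
    and "\<And>z. z \<in> J \<Longrightarrow> Z z \<in> borel_measurable M" "\<And>z. z \<in> J \<Longrightarrow> A z \<in> sets borel"
    and "\<And>l. (\<integral>\<omega>. W \<omega> * iexp (\<Sum>z\<in>J. l z * Z z \<omega>) \<partial>M) = 0"
  shows "(\<integral>\<omega>. W \<omega> * (\<Prod>z\<in>J. indicator (A z) (Z z \<omega>)) \<partial>M) = 0"
  using assms
proof (induction J arbitrary: W rule: finite_induct)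
  case empty
  then show ?case by simp
next
  case (insert y J)
  have [measurable]: "Z y \<in> borel_measurable M" "A y \<in> sets borel"
    "\<And>z. z \<in> J \<Longrightarrow> Z z \<in> borel_measurable M"
    using insert by auto
  have "integrable M (\<lambda>\<omega>. W \<omega> * indicator (A y) (Z y \<omega>))"
    by (rule integrable_mult_bounded) (use insert in \<open>auto split: split_indicator\<close>)
  moreover have "(\<integral>\<omega>. (W \<omega> * indicator (A y) (Z y \<omega>)) * iexp (\<Sum>z\<in>J. l z * Z z \<omega>) \<partial>M) = 0" for l
  proof -
    have "(\<integral>\<omega>. (W \<omega> * iexp (\<Sum>z\<in>J. l z * Z z \<omega>)) * indicator (A y) (Z y \<omega>) \<partial>M) = 0"
    proof (rule fourier_zero_imp_integral_zero)
      show "integrable M (\<lambda>\<omega>. W \<omega> * iexp (\<Sum>z\<in>J. l z * Z z \<omega>))"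
        by (rule integrable_mult_bounded) (use insert in auto)
      fix k
      have sum: "(\<Sum>z\<in>insert y J. (l(y := k)) z * Z z \<omega>) = k * Z y \<omega> + (\<Sum>z\<in>J. l z * Z z \<omega>)" for \<omega>
        using insert.hyps by (auto intro!: sum.cong)
      have exp: "w * iexp a * iexp b = w * iexp (b + a)" for w a b
        by (simp add: exp_add ring_distribs)
      show "(\<integral>\<omega>. W \<omega> * iexp (\<Sum>z\<in>J. l z * Z z \<omega>) * iexp (k * Z y \<omega>) \<partial>M) = 0"
        unfolding exp sum[symmetric] by (rule insert.prems(4))
    qed auto
    then show ?thesis by (simp add: mult_ac)
  qed
  ultimately have "(\<integral>\<omega>. (W \<omega> * indicator (A y) (Z y \<omega>)) * (\<Prod>z\<in>J. indicator (A z) (Z z \<omega>)) \<partial>M) = 0"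
    using insert by (intro insert.IH) auto
  with insert.hyps show ?case by (simp add: mult_ac)
qed

text \<open>
  The events on which the integral of \<open>W\<close> vanishes form a Dynkin system, and by the finite case they
  include the finite-dimensional cylinders, which are stable under intersection and generate the
  sigma-algebra of the field on \<open>I\<close>.
\<close>

lemma fourier_zero_imp_field_sigma_zero:
  fixes W :: "'w \<Rightarrow> real" and Z :: "'a \<Rightarrow> 'w \<Rightarrow> real"
  assumes W: "integrable M W" and meas: "\<And>z. z \<in> I \<Longrightarrow> Z z \<in> borel_measurable M"
    and zero: "\<And>J l. finite J \<Longrightarrow> J \<subseteq> I \<Longrightarrow>
      (\<integral>\<omega>. complex_of_real (W \<omega>) * iexp (\<Sum>z\<in>J. l z * Z z \<omega>) \<partial>M) = 0"
    and E: "E \<in> field_sigma M Z I"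
  shows "(\<integral>\<omega>\<in>E. W \<omega> \<partial>M) = 0"
proof -
  define C where "C = (\<lambda>(J, A). {\<omega> \<in> space M. \<forall>z\<in>J. Z z \<omega> \<in> A z}) `
    {(J, A). finite J \<and> J \<subseteq> I \<and> (\<forall>z. A z \<in> sets borel)}"
  have C_I: "{\<omega> \<in> space M. \<forall>z\<in>J. Z z \<omega> \<in> A z} \<in> C"
    if "finite J" "J \<subseteq> I" "\<And>z. A z \<in> sets borel" for J A
    using that unfolding C_def by (intro image_eqI[of _ _ "(J, A)"]) auto
  have "{Z s -` B \<inter> space M |s B. s \<in> I \<and> B \<in> sets borel} \<subseteq> C"
  proof safe
    fix s B assume "s \<in> I" "B \<in> sets (borel :: real measure)"
    then show "Z s -` B \<inter> space M \<in> C"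
      using C_I[of "{s}" "\<lambda>_. B"] by (auto simp: vimage_def Collect_conj_eq Int_commute)
  qed
  then have E': "E \<in> sigma_sets (space M) C"
    using E unfolding field_sigma_def by (meson sigma_sets_mono' subsetD)
  have C_sets: "c \<in> sets M" if "c \<in> C" for c
  proof -
    from that obtain J A where c: "c = {\<omega> \<in> space M. \<forall>z\<in>J. Z z \<omega> \<in> A z}"
      and JA: "finite J" "J \<subseteq> I" "\<forall>z. A z \<in> sets borel"
      unfolding C_def by auto
    have "{\<omega> \<in> space M. Z z \<omega> \<in> A z} \<in> sets M" if "z \<in> J" for z
      using meas[of z] JA that measurable_sets[of "Z z" M borel "A z"]
      by (auto simp: vimage_def Collect_conj_eq Int_commute)
    then show ?thesis unfolding c using JA(1) by (intro sets.sets_Collect_finite_All) auto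
  qed
  have sub: "sigma_sets (space M) C \<subseteq> sets M"
    using C_sets by (intro sets.sigma_sets_subset) auto
  have int: "set_integrable M F W" if "F \<in> sets M" for F
    using integrable_mult_indicator[OF that W] by (simp add: set_integrable_def)
  have "Int_stable C"
  proof (rule Int_stableI)
    fix a b assume "a \<in> C" "b \<in> C"
    then obtain J A K B where a: "a = {\<omega> \<in> space M. \<forall>z\<in>J. Z z \<omega> \<in> A z}"
      and JA: "finite J" "J \<subseteq> I" "\<forall>z. A z \<in> sets borel"
      and b: "b = {\<omega> \<in> space M. \<forall>z\<in>K. Z z \<omega> \<in> B z}"
      and KB: "finite K" "K \<subseteq> I" "\<forall>z. B z \<in> sets borel"
      unfolding C_def by auto
    have "a \<inter> b = {\<omega> \<in> space M. \<forall>z\<in>J \<union> K.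
        Z z \<omega> \<in> (if z \<in> J then A z else UNIV) \<inter> (if z \<in> K then B z else UNIV)}"
      unfolding a b by auto
    also have "\<dots> \<in> C" using JA KB by (intro C_I) auto
    finally show "a \<inter> b \<in> C" .
  qed
  moreover have "C \<subseteq> Pow (space M)" by (auto simp: C_def)
  ultimately show ?thesis using E'
  proof (induction E rule: sigma_sets_induct_disjoint)
    case (basic E)
    then obtain J A where c: "E = {\<omega> \<in> space M. \<forall>z\<in>J. Z z \<omega> \<in> A z}"
      and JA: "finite J" "J \<subseteq> I" "\<forall>z. A z \<in> sets borel"
      unfolding C_def by auto
    have "complex_of_real (\<integral>\<omega>\<in>E. W \<omega> \<partial>M) = (\<integral>\<omega>. complex_of_real (indicator E \<omega> * W \<omega>) \<partial>M)"
      unfolding set_lebesgue_integral_def real_scaleR_def by (rule integral_complex_of_real[symmetric])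
    also have "\<dots> = (\<integral>\<omega>. complex_of_real (W \<omega>) * (\<Prod>z\<in>J. indicator (A z) (Z z \<omega>)) \<partial>M)"
    proof (rule Bochner_Integration.integral_cong)
      fix \<omega> assume \<omega>: "\<omega> \<in> space M"
      have "(\<Prod>z\<in>J. indicator (A z) (Z z \<omega>)) = (indicator E \<omega> :: complex)"
      proof (cases "\<omega> \<in> E")
        case True
        then show ?thesis by (simp add: c)
      next
        case False
        then obtain z where "z \<in> J" "Z z \<omega> \<notin> A z" using c \<omega> by auto
        then show ?thesis using False JA(1) by (simp add: prod_zero_iff) (auto simp: indicator_def)
      qed
      then show "complex_of_real (indicator E \<omega> * W \<omega>) = complex_of_real (W \<omega>) * (\<Prod>z\<in>J. indicator (A z) (Z z \<omega>))"
        by (auto split: split_indicator)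
    qed simp
    also have "\<dots> = 0"
      by (rule finite_fourier_zero_imp_integral_zero) (use W JA meas zero in auto)
    finally show ?case by simp
  next
    case empty
    then show ?case by (simp add: set_lebesgue_integral_def)
  next
    case (compl E)
    have "E \<in> sets M" using compl sub by auto
    have "(\<integral>\<omega>\<in>space M - E. W \<omega> \<partial>M) = (\<integral>\<omega>. W \<omega> - indicator E \<omega> * W \<omega> \<partial>M)"
      unfolding set_lebesgue_integral_def
      by (intro Bochner_Integration.integral_cong) (auto split: split_indicator)
    also have "\<dots> = (\<integral>\<omega>. W \<omega> \<partial>M) - (\<integral>\<omega>\<in>E. W \<omega> \<partial>M)"
      using W int[OF \<open>E \<in> sets M\<close>] unfolding set_lebesgue_integral_def set_integrable_def
      by (subst Bochner_Integration.integral_diff) auto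
    also have "(\<integral>\<omega>. W \<omega> \<partial>M) = 0" using zero[of "{}" "\<lambda>_. 0"] by simp
    finally show ?case using compl.IH by simp
  next
    case (union F)
    then have "range F \<subseteq> sets M" using sub by auto
    then have "(\<integral>\<omega>\<in>(\<Union>i. F i). W \<omega> \<partial>M) = (\<Sum>i. (\<integral>\<omega>\<in>F i. W \<omega> \<partial>M))"
      using union.hyps(1) int
      by (intro lebesgue_integral_countable_add) (auto simp: disjoint_family_on_def)
    then show ?case using union.IH by simp
  qed
qed


section \<open>Gaussian fields and orthogonality\<close>

lemma integrable_mult_of_squares:
  fixes X Y :: "'w \<Rightarrow> real"
  assumes "X \<in> borel_measurable M" "Y \<in> borel_measurable M"
    and "integrable M (\<lambda>\<omega>. (X \<omega>)\<^sup>2)" "integrable M (\<lambda>\<omega>. (Y \<omega>)\<^sup>2)"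
  shows "integrable M (\<lambda>\<omega>. X \<omega> * Y \<omega>)"
proof (rule Bochner_Integration.integrable_bound)
  show "integrable M (\<lambda>\<omega>. (X \<omega>)\<^sup>2 + (Y \<omega>)\<^sup>2)" using assms by simp
  have "\<bar>x * y\<bar> \<le> x\<^sup>2 + y\<^sup>2" for x y :: real
  proof -
    have "2 * (\<bar>x\<bar> * \<bar>y\<bar>) \<le> \<bar>x\<bar>\<^sup>2 + \<bar>y\<bar>\<^sup>2"
      using sum_squares_bound[of "\<bar>x\<bar>" "\<bar>y\<bar>"] by (simp add: mult.assoc)
    moreover have "0 \<le> \<bar>x\<bar> * \<bar>y\<bar>" by simp
    ultimately show ?thesis unfolding abs_mult power2_abs by linarith
  qed
  then show "AE \<omega> in M. norm (X \<omega> * Y \<omega>) \<le> norm ((X \<omega>)\<^sup>2 + (Y \<omega>)\<^sup>2)" by simp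
qed (use assms in auto)

context prob_space
begin

text \<open>
  The degenerate case is included, with variance zero; this makes the formula applicable to linear
  combinations without any discussion of their variance.
\<close>

lemma gaussian_rv_fourier:
  assumes "gaussian_rv M W"
  shows "(\<integral>\<omega>. iexp (W \<omega>) \<partial>M) = iexp (expectation W) * exp (- variance W / 2)"
proof -
  have [measurable]: "W \<in> borel_measurable M" using assms by (simp add: gaussian_rv_def)
  consider m where "AE \<omega> in M. W \<omega> = m"
    | m \<sigma> where "0 < \<sigma>" "distributed M lborel W (\<lambda>x. ennreal (normal_density m \<sigma> x))"
    using assms by (auto simp: gaussian_rv_def)
  then show ?thesis
  proof cases
    case 1
    have "expectation W = expectation (\<lambda>_. m)" using 1 by (intro integral_cong_AE) auto
    then have m: "expectation W = m" by (simp add: prob_space)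
    have "variance W = expectation (\<lambda>_. 0)" using 1 by (intro integral_cong_AE) (auto simp: m)
    moreover have "(\<integral>\<omega>. iexp (W \<omega>) \<partial>M) = (\<integral>\<omega>. iexp m \<partial>M)" using 1 by (intro integral_cong_AE) auto
    ultimately show ?thesis by (simp add: m prob_space)
  next
    case 2
    define Y where "Y \<omega> = (W \<omega> - m) / \<sigma>" for \<omega>
    have [measurable]: "Y \<in> borel_measurable M" by (auto simp: Y_def[abs_def])
    have "distributed M lborel Y (\<lambda>x. ennreal (std_normal_density x))"
      using normal_standard_normal_convert[OF 2(1), of W m] 2(2) by (simp add: Y_def[abs_def])
    then have "distr M borel Y = std_normal_distribution"
      by (simp add: distributed_def cong: distr_cong)
    then have "char (distr M borel Y) \<sigma> = exp (- (\<sigma>\<^sup>2) / 2)"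
      by (simp add: char_std_normal_distribution)
    then have Y: "(\<integral>\<omega>. iexp (\<sigma> * Y \<omega>) \<partial>M) = exp (- (\<sigma>\<^sup>2) / 2)"
      by (simp add: char_def integral_distr)
    have "iexp (W \<omega>) = iexp m * iexp (\<sigma> * Y \<omega>)" for \<omega>
      using 2(1) by (simp add: Y_def exp_add[symmetric] ring_distribs[symmetric])
    then have "(\<integral>\<omega>. iexp (W \<omega>) \<partial>M) = iexp m * exp (- (\<sigma>\<^sup>2) / 2)"
      using Y by simp
    then show ?thesis
      using normal_distributed_expectation[OF 2] normal_distributed_variance[OF 2] by simp
  qed
qed

text \<open>
  For the centred \<open>X\<close>, the function \<open>\<phi> a = E (exp (\<i> (a X + Y)))\<close> has the derivative
  \<open>\<i> E (X exp (\<i> Y))\<close> in \<open>0\<close>. Since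
  \<open>X\<close> and \<open>Y\<close> are uncorrelated, \<open>\<phi> a\<close> is the product of \<open>\<phi> 0\<close> and \<open>exp (- a\<^sup>2 v / 2)\<close> with the
  variance \<open>v\<close> of \<open>X\<close>, so that this derivative is zero. Differentiation under the integral sign is avoided by
  comparing quadratic error bounds.
\<close>

lemma gaussian_uncorrelated_fourier_zero:
  assumes [measurable]: "X \<in> borel_measurable M" "Y \<in> borel_measurable M"
    and sq: "integrable M (\<lambda>\<omega>. (X \<omega>)\<^sup>2)" "integrable M (\<lambda>\<omega>. (Y \<omega>)\<^sup>2)"
    and gauss: "\<And>a. gaussian_rv M (\<lambda>\<omega>. a * X \<omega> + Y \<omega>)"
    and uncorrelated: "covariance M X Y = 0"
  shows "(\<integral>\<omega>. complex_of_real (X \<omega> - expectation X) * iexp (Y \<omega>) \<partial>M) = 0"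
proof -
  define X' where "X' \<omega> = X \<omega> - expectation X" for \<omega>
  define Y' where "Y' \<omega> = Y \<omega> - expectation Y" for \<omega>
  have [measurable]: "X' \<in> borel_measurable M" "Y' \<in> borel_measurable M"
    by (auto simp: X'_def[abs_def] Y'_def[abs_def])
  have int: "integrable M X" "integrable M Y"
    using sq by (auto intro: square_integrable_imp_integrable)
  have int_XY: "integrable M (\<lambda>\<omega>. X \<omega> * Y \<omega>)" using sq by (intro integrable_mult_of_squares) auto
  have sq': "integrable M (\<lambda>\<omega>. (X' \<omega>)\<^sup>2)" "integrable M (\<lambda>\<omega>. (Y' \<omega>)\<^sup>2)"
    "integrable M (\<lambda>\<omega>. X' \<omega> * Y' \<omega>)"
    unfolding X'_def Y'_def power2_diff using sq int int_XY by (auto simp: algebra_simps)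
  have int': "integrable M X'" using int by (simp add: X'_def[abs_def])
  define v w where "v = (\<integral>\<omega>. (X' \<omega>)\<^sup>2 \<partial>M)" and "w = (\<integral>\<omega>. (Y' \<omega>)\<^sup>2 \<partial>M)"
  have XY: "(\<integral>\<omega>. X' \<omega> * Y' \<omega> \<partial>M) = 0"
    using uncorrelated by (simp add: covariance_def X'_def Y'_def)
  define \<phi> where "\<phi> a = (\<integral>\<omega>. iexp (a * X' \<omega> + Y \<omega>) \<partial>M)" for a
  have \<phi>: "\<phi> a = exp (- (a\<^sup>2 * v / 2)) * \<phi> 0" for a
  proof -
    have \<phi>1: "\<phi> a = iexp (expectation Y) * exp (- (a\<^sup>2 * v + w) / 2)" for a
    proof -
      have E: "expectation (\<lambda>\<omega>. a * X \<omega> + Y \<omega>) = a * expectation X + expectation Y"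
        using int by simp
      have "variance (\<lambda>\<omega>. a * X \<omega> + Y \<omega>) =
          (\<integral>\<omega>. a\<^sup>2 * (X' \<omega>)\<^sup>2 + 2 * a * (X' \<omega> * Y' \<omega>) + (Y' \<omega>)\<^sup>2 \<partial>M)"
        unfolding E X'_def Y'_def
        by (intro Bochner_Integration.integral_cong) (auto simp: power2_eq_square algebra_simps)
      also have "\<dots> = a\<^sup>2 * v + w" using sq' XY by (simp add: v_def w_def)
      finally have var: "variance (\<lambda>\<omega>. a * X \<omega> + Y \<omega>) = a\<^sup>2 * v + w" .
      have "\<phi> a = (\<integral>\<omega>. iexp (- a * expectation X) * iexp (a * X \<omega> + Y \<omega>) \<partial>M)"
        unfolding \<phi>_def X'_def
        by (intro Bochner_Integration.integral_cong) (auto simp: exp_add[symmetric] algebra_simps)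
      also have "\<dots> = iexp (- a * expectation X) * (\<integral>\<omega>. iexp (a * X \<omega> + Y \<omega>) \<partial>M)"
        by (rule integral_mult_right_zero)
      also have "\<dots> = iexp (- a * expectation X) *
          (iexp (a * expectation X + expectation Y) * exp (- (a\<^sup>2 * v + w) / 2))"
        unfolding gaussian_rv_fourier[OF gauss[of a]] var unfolding E ..
      also have "\<dots> = iexp (expectation Y) * exp (- (a\<^sup>2 * v + w) / 2)"
        by (simp add: mult.assoc[symmetric] exp_add[symmetric] ring_distribs)
      finally show ?thesis .
    qed
    have "exp (- (a\<^sup>2 * v + w) / 2) = exp (- (a\<^sup>2 * v / 2)) * exp (- w / 2)"
      by (simp add: exp_add[symmetric] add_divide_distrib)
    then show ?thesis using \<phi>1[of a] \<phi>1[of 0] by simp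
  qed
  define I where "I = (\<integral>\<omega>. complex_of_real (X' \<omega>) * iexp (Y \<omega>) \<partial>M)"
  have int_I: "integrable M (\<lambda>\<omega>. complex_of_real (X' \<omega>) * iexp (Y \<omega>))"
    using int' by (intro integrable_mult_bounded) auto
  have int_exp: "integrable M (\<lambda>\<omega>. iexp (f \<omega>))" if [measurable]: "f \<in> borel_measurable M" for f
    by (rule integrable_const_bound[of _ 1]) auto
  have "v \<ge> 0" by (simp add: v_def)
  \<comment> \<open>The first-order expansion of \<open>exp (\<i> a X')\<close> has a mean error of at most \<open>a\<^sup>2 v / 2\<close>, and
      \<open>\<phi> a\<close> differs from \<open>\<phi> 0\<close> by no more than that.\<close>
  have bound: "norm I \<le> a * v" if "a > 0" for a
  proof -
    have "\<phi> a - \<phi> 0 - \<i> * a * I =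
        (\<integral>\<omega>. iexp (a * X' \<omega> + Y \<omega>) - iexp (Y \<omega>) - \<i> * a * (complex_of_real (X' \<omega>) * iexp (Y \<omega>)) \<partial>M)"
      using int_I int_exp[of "\<lambda>\<omega>. a * X' \<omega> + Y \<omega>"] int_exp[of Y] by (simp add: \<phi>_def I_def)
    also have "\<dots> = (\<integral>\<omega>. (iexp (a * X' \<omega>) - (1 + \<i> * (a * X' \<omega>))) * iexp (Y \<omega>) \<partial>M)"
      by (intro Bochner_Integration.integral_cong) (auto simp: exp_add ring_distribs)
    also have "norm \<dots> \<le> (\<integral>\<omega>. (a * X' \<omega>)\<^sup>2 / 2 \<partial>M)"
    proof (rule order_trans[OF integral_norm_bound], rule Bochner_Integration.integral_mono)
      have *: "norm (iexp x - (1 + \<i> * x)) \<le> x\<^sup>2 / 2" for x :: real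
        using iexp_approx1[of x 1] by (simp add: eval_nat_numeral)
      then show "norm ((iexp (a * X' \<omega>) - (1 + \<i> * (a * X' \<omega>))) * iexp (Y \<omega>)) \<le> (a * X' \<omega>)\<^sup>2 / 2" for \<omega>
        using *[of "a * X' \<omega>"] by (simp add: norm_mult)
      show "integrable M (\<lambda>\<omega>. (a * X' \<omega>)\<^sup>2 / 2)" using sq' by (simp add: power_mult_distrib)
      have "integrable M (\<lambda>\<omega>. iexp (a * X' \<omega>) - (1 + \<i> * complex_of_real (a * X' \<omega>)))"
        using int' int_exp[of "\<lambda>\<omega>. a * X' \<omega>"] by simp
      then show "integrable M (\<lambda>\<omega>. norm ((iexp (a * X' \<omega>) - (1 + \<i> * (a * X' \<omega>))) * iexp (Y \<omega>)))"
        by (intro integrable_norm integrable_mult_bounded) auto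
    qed
    also have "\<dots> = a\<^sup>2 * v / 2" by (simp add: power_mult_distrib v_def)
    finally have 1: "norm (\<phi> a - \<phi> 0 - \<i> * a * I) \<le> a\<^sup>2 * v / 2" .
    have "norm (\<phi> 0) \<le> (\<integral>\<omega>. 1 \<partial>M)"
      unfolding \<phi>_def using integral_norm_bound[of M "\<lambda>\<omega>. iexp (0 * X' \<omega> + Y \<omega>)"] by simp
    then have \<phi>0: "norm (\<phi> 0) \<le> 1" by (simp add: prob_space)
    have "\<phi> a - \<phi> 0 = complex_of_real (exp (- (a\<^sup>2 * v / 2)) - 1) * \<phi> 0"
      by (subst \<phi>) (simp add: left_diff_distrib exp_of_real)
    then have "norm (\<phi> a - \<phi> 0) = \<bar>exp (- (a\<^sup>2 * v / 2)) - 1\<bar> * norm (\<phi> 0)"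
      by (simp only: norm_mult norm_of_real)
    also have "\<dots> \<le> \<bar>exp (- (a\<^sup>2 * v / 2)) - 1\<bar>" using \<phi>0 by (intro mult_left_le) auto
    also have "\<dots> \<le> a\<^sup>2 * v / 2"
    proof -
      have "exp (- (a\<^sup>2 * v / 2)) \<le> 1" using \<open>v \<ge> 0\<close> by simp
      then show ?thesis using exp_ge_add_one_self[of "- (a\<^sup>2 * v / 2)"] by linarith
    qed
    finally have "norm (\<phi> a - \<phi> 0) \<le> a\<^sup>2 * v / 2" .
    moreover have "norm (\<i> * a * I) \<le> norm (\<phi> a - \<phi> 0) + norm (\<phi> a - \<phi> 0 - \<i> * a * I)"
      using norm_triangle_ineq4[of "\<phi> a - \<phi> 0" "\<phi> a - \<phi> 0 - \<i> * a * I"] by simp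
    ultimately have "norm (\<i> * a * I) \<le> a\<^sup>2 * v" using 1 by simp
    then have "a * norm I \<le> a * (a * v)"
      using \<open>a > 0\<close> by (simp add: norm_mult power2_eq_square mult.assoc)
    then show ?thesis using \<open>a > 0\<close> by simp
  qed
  have "norm I \<le> 0"
  proof (rule field_le_epsilon)
    fix e :: real assume "e > 0"
    have "norm I \<le> e / (v + 1) * v" using \<open>e > 0\<close> \<open>v \<ge> 0\<close> by (intro bound) auto
    also have "\<dots> \<le> e" using \<open>e > 0\<close> \<open>v \<ge> 0\<close> by (simp add: field_simps)
    finally show "norm I \<le> 0 + e" by simp
  qed
  then show ?thesis by (simp add: I_def X'_def)
qed

end

lemma covariance_commute: "covariance M X Y = covariance M Y X"
  by (simp add: covariance_def mult.commute)

locale square_integrable_gaussian_field = prob_space M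
  for M :: "'w measure" and T :: "'a set" and u :: "'a \<Rightarrow> 'w \<Rightarrow> real" +
  assumes gaussian: "gaussian_field M T u"
    and measurable_field: "s \<in> T \<Longrightarrow> u s \<in> borel_measurable M"
    and square_integrable: "s \<in> T \<Longrightarrow> integrable M (\<lambda>\<omega>. (u s \<omega>)\<^sup>2)"
begin

lemma integrable_field: "s \<in> T \<Longrightarrow> integrable M (u s)"
  by (rule square_integrable_imp_integrable[OF measurable_field square_integrable])

lemma integrable_field_mult: "s \<in> T \<Longrightarrow> t \<in> T \<Longrightarrow> integrable M (\<lambda>\<omega>. u s \<omega> * u t \<omega>)"
  by (intro integrable_mult_of_squares measurable_field square_integrable)

lemma linear_combination:
  assumes "finite P" "P \<subseteq> T"
  shows "(\<lambda>\<omega>. \<Sum>y\<in>P. v y * u y \<omega>) \<in> borel_measurable M"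
    and "integrable M (\<lambda>\<omega>. \<Sum>y\<in>P. v y * u y \<omega>)"
    and "integrable M (\<lambda>\<omega>. (\<Sum>y\<in>P. v y * u y \<omega>)\<^sup>2)"
proof -
  show "(\<lambda>\<omega>. \<Sum>y\<in>P. v y * u y \<omega>) \<in> borel_measurable M"
    using assms measurable_field by (intro borel_measurable_sum borel_measurable_times) auto
  show "integrable M (\<lambda>\<omega>. \<Sum>y\<in>P. v y * u y \<omega>)"
    using assms integrable_field by (intro Bochner_Integration.integrable_sum integrable_mult_right) auto
  have "(\<lambda>\<omega>. (\<Sum>y\<in>P. v y * u y \<omega>)\<^sup>2) = (\<lambda>\<omega>. \<Sum>y\<in>P. \<Sum>z\<in>P. (v y * v z) * (u y \<omega> * u z \<omega>))"
    by (simp add: power2_eq_square sum_product mult_ac)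
  then show "integrable M (\<lambda>\<omega>. (\<Sum>y\<in>P. v y * u y \<omega>)\<^sup>2)"
    using assms integrable_field_mult
    by (auto intro!: Bochner_Integration.integrable_sum integrable_mult_right)
qed

lemma covariance_linear_combination:
  assumes "finite P" "P \<subseteq> T" "Z \<in> borel_measurable M" "integrable M (\<lambda>\<omega>. (Z \<omega>)\<^sup>2)"
  shows "covariance M (\<lambda>\<omega>. \<Sum>y\<in>P. v y * u y \<omega>) Z = (\<Sum>y\<in>P. v y * covariance M (u y) Z)"
proof -
  have intZ: "integrable M Z" using assms(3,4) by (rule square_integrable_imp_integrable)
  have E: "expectation (\<lambda>\<omega>. \<Sum>y\<in>P. v y * u y \<omega>) = (\<Sum>y\<in>P. v y * expectation (u y))"
    using assms integrable_field by (subst Bochner_Integration.integral_sum) auto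
  have int: "integrable M (\<lambda>\<omega>. (u y \<omega> - expectation (u y)) * (Z \<omega> - expectation Z))" if "y \<in> P" for y
  proof -
    have "integrable M (\<lambda>\<omega>. u y \<omega> * Z \<omega>)"
      using that assms by (intro integrable_mult_of_squares measurable_field square_integrable) auto
    then show ?thesis using that assms integrable_field[of y] intZ by (auto simp: algebra_simps)
  qed
  have centred: "(\<Sum>y\<in>P. v y * u y \<omega>) - (\<Sum>y\<in>P. v y * expectation (u y)) =
      (\<Sum>y\<in>P. v y * (u y \<omega> - expectation (u y)))" for \<omega>
    by (simp add: right_diff_distrib sum_subtractf)
  have "covariance M (\<lambda>\<omega>. \<Sum>y\<in>P. v y * u y \<omega>) Z =
      (\<integral>\<omega>. (\<Sum>y\<in>P. v y * ((u y \<omega> - expectation (u y)) * (Z \<omega> - expectation Z))) \<partial>M)"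
    unfolding covariance_def E centred by (simp add: sum_distrib_right mult.assoc)
  also have "\<dots> = (\<Sum>y\<in>P. v y * covariance M (u y) Z)"
    using int by (subst Bochner_Integration.integral_sum) (auto simp: covariance_def)
  finally show ?thesis .
qed

lemma gaussian_sum_linear_combinations:
  assumes "finite P" "P \<subseteq> T" "finite J" "J \<subseteq> T"
  shows "gaussian_rv M (\<lambda>\<omega>. a * (\<Sum>y\<in>P. v y * u y \<omega>) + (\<Sum>z\<in>J. l z * u z \<omega>))"
proof -
  define c where "c s = (if s \<in> P then a * v s else 0) + (if s \<in> J then l s else 0)" for s
  have "(\<Sum>s\<in>P \<union> J. c s * u s \<omega>) = a * (\<Sum>y\<in>P. v y * u y \<omega>) + (\<Sum>z\<in>J. l z * u z \<omega>)" for \<omega>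
  proof -
    have "(\<Sum>s\<in>P \<union> J. c s * u s \<omega>) = (\<Sum>s\<in>P \<union> J. if s \<in> P then a * v s * u s \<omega> else 0) +
        (\<Sum>s\<in>P \<union> J. if s \<in> J then l s * u s \<omega> else 0)"
      unfolding sum.distrib[symmetric] by (intro sum.cong) (auto simp: c_def distrib_right)
    also have "\<dots> = (\<Sum>s\<in>P. a * v s * u s \<omega>) + (\<Sum>s\<in>J. l s * u s \<omega>)"
      using assms by (simp add: sum.inter_restrict[symmetric] Int_absorb1 Int_absorb2)
    finally show ?thesis by (simp add: sum_distrib_left mult.assoc)
  qed
  moreover have "gaussian_rv M (\<lambda>\<omega>. \<Sum>s\<in>P \<union> J. c s * u s \<omega>)"
    using gaussian assms unfolding gaussian_field_def by blast
  ultimately show ?thesis by simp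
qed

text \<open>
  Gaussianity upgrades orthogonality to conditional mean zero given the field on \<open>I\<close>. The set \<open>I\<close> may
  be infinite since only finite linear combinations enter the Fourier transforms.
\<close>

lemma uncorrelated_imp_set_integral_zero:
  fixes v :: "'a \<Rightarrow> real"
  assumes P: "finite P" "P \<subseteq> T" and I: "I \<subseteq> T"
  defines "X \<equiv> \<lambda>\<omega>. \<Sum>y\<in>P. v y * u y \<omega>"
  assumes uncorrelated: "\<And>z. z \<in> I \<Longrightarrow> covariance M X (u z) = 0"
    and E: "E \<in> field_sigma M u I"
  shows "(\<integral>\<omega>\<in>E. (X \<omega> - expectation X) \<partial>M) = 0"
proof (rule fourier_zero_imp_field_sigma_zero[OF _ _ _ E])
  have X: "X \<in> borel_measurable M" "integrable M X" "integrable M (\<lambda>\<omega>. (X \<omega>)\<^sup>2)"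
    using linear_combination[OF P, of v] by (simp_all add: X_def)
  show "integrable M (\<lambda>\<omega>. X \<omega> - expectation X)" using X by simp
  show "u z \<in> borel_measurable M" if "z \<in> I" for z using that I measurable_field by auto
  fix J and l :: "'a \<Rightarrow> real" assume J: "finite J" "J \<subseteq> I"
  then have JT: "J \<subseteq> T" using I by auto
  show "(\<integral>\<omega>. complex_of_real (X \<omega> - expectation X) * iexp (\<Sum>z\<in>J. l z * u z \<omega>) \<partial>M) = 0"
  proof (rule gaussian_uncorrelated_fourier_zero)
    show "gaussian_rv M (\<lambda>\<omega>. a * X \<omega> + (\<Sum>z\<in>J. l z * u z \<omega>))" for a
      unfolding X_def by (rule gaussian_sum_linear_combinations[OF P J(1) JT])
    have "covariance M (\<lambda>\<omega>. \<Sum>z\<in>J. l z * u z \<omega>) X = (\<Sum>z\<in>J. l z * covariance M (u z) X)"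
      by (rule covariance_linear_combination[OF J(1) JT X(1,3)])
    then have "covariance M X (\<lambda>\<omega>. \<Sum>z\<in>J. l z * u z \<omega>) = (\<Sum>z\<in>J. l z * covariance M X (u z))"
      by (simp add: covariance_commute[of M _ X])
    also have "\<dots> = 0" using uncorrelated J by (intro sum.neutral) auto
    finally show "covariance M X (\<lambda>\<omega>. \<Sum>z\<in>J. l z * u z \<omega>) = 0" .
  qed (use X linear_combination[OF J(1) JT] in auto)
qed

end


section \<open>Conditional independence and the covariance beyond a splitting set\<close>

text \<open>
  Conditional independence is given for events only. For a fixed \<open>b\<close>, the difference \<open>g\<close> between the
  indicator of \<open>b\<close> and its conditional probability given \<open>C\<close> is orthogonal to all events of \<open>F\<close>. So its
  conditional expectation given \<open>F\<close> is zero, and \<open>g\<close> is orthogonal to every integrable \<open>f\<close> that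
  is measurable with respect to \<open>F\<close>. It remains to move the conditional expectation from the
  indicator of \<open>b\<close> to \<open>f\<close>, which is possible because conditional expectation is self-adjoint.
\<close>

lemma (in prob_space) splits_imp_set_integral_cond_exp:
  fixes f :: "'a \<Rightarrow> real"
  assumes C: "subalgebra M (sigma (space M) C)"
    and splits: "splits M C A B"
    and F: "subalgebra M F" "sets F \<subseteq> A" "f \<in> borel_measurable F" "integrable M f"
    and b: "b \<in> B" "b \<in> sets M"
  shows "(\<integral>\<omega>\<in>b. f \<omega> \<partial>M) = (\<integral>\<omega>\<in>b. real_cond_exp M (sigma (space M) C) f \<omega> \<partial>M)"
proof -
  let ?C = "sigma (space M) C"
  interpret C: finite_measure_subalgebra M ?C by unfold_locales (rule C)
  interpret F: finite_measure_subalgebra M F by unfold_locales (rule F(1))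
  define p where "p = real_cond_exp M ?C (indicator b)"
  have [measurable]: "b \<in> sets M" by (rule b(2))
  have [measurable]: "f \<in> borel_measurable M" using F(4) by simp
  have [measurable]: "p \<in> borel_measurable M" and pC: "p \<in> borel_measurable ?C"
    by (simp_all add: p_def)
  have int_ind: "integrable M (indicator a :: 'a \<Rightarrow> real)" if "a \<in> sets M" for a
    using that by (simp add: emeasure_eq_measure)
  have p01: "AE \<omega> in M. 0 \<le> p \<omega>" "AE \<omega> in M. p \<omega> \<le> 1"
    unfolding p_def using int_ind[OF b(2)]
    by (auto intro!: C.real_cond_exp_ge_c C.real_cond_exp_le_c split: split_indicator)
  define g where "g \<omega> = indicator b \<omega> - p \<omega>" for \<omega>
  have [measurable]: "g \<in> borel_measurable M" by (simp add: g_def[abs_def])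
  have int_bounded: "integrable M (\<lambda>\<omega>. h \<omega> * k \<omega>)"
    if "integrable M h" "k \<in> borel_measurable M" "AE \<omega> in M. norm (k \<omega>) \<le> 1" for h k :: "'a \<Rightarrow> real"
  proof (rule Bochner_Integration.integrable_bound[OF that(1)])
    show "AE \<omega> in M. norm (h \<omega> * k \<omega>) \<le> norm (h \<omega>)"
      using that(3) by eventually_elim (auto simp: abs_mult intro!: mult_left_le)
  qed (use that in auto)
  have p1: "AE \<omega> in M. norm (p \<omega>) \<le> 1" using p01 by eventually_elim auto
  have g1: "AE \<omega> in M. norm (g \<omega>) \<le> 1"
    using p01 by eventually_elim (auto simp: g_def split: split_indicator)
  have int_one: "integrable M (\<lambda>_. 1::real)" by simp
  have int_g: "integrable M g" using int_bounded[OF int_one _ g1] by simp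
  have int_p: "integrable M p" using int_bounded[OF int_one _ p1] by simp
  have "AE \<omega> in M. real_cond_exp M F g \<omega> = 0"
  proof (rule F.real_cond_exp_charact)
    fix a assume a: "a \<in> sets F"
    then have [measurable]: "a \<in> sets M" using F(1) by (auto simp: subalgebra_def)
    have "(\<integral>\<omega>. indicator (a \<inter> b) \<omega> \<partial>M) = (\<integral>\<omega>. real_cond_exp M ?C (indicator (a \<inter> b)) \<omega> \<partial>M)"
      by (rule C.real_cond_exp_int(2)[OF int_ind, symmetric]) simp
    also have "\<dots> = (\<integral>\<omega>. p \<omega> * real_cond_exp M ?C (indicator a) \<omega> \<partial>M)"
    proof (rule integral_cong_AE)
      have "AE \<omega> in M. real_cond_exp M ?C (indicator (a \<inter> b)) \<omega> =
          real_cond_exp M ?C (indicator a) \<omega> * p \<omega>"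
        using splits a F(2) b(1) unfolding splits_def p_def by blast
      then show "AE \<omega> in M. real_cond_exp M ?C (indicator (a \<inter> b)) \<omega> =
          p \<omega> * real_cond_exp M ?C (indicator a) \<omega>"
        by eventually_elim simp
    qed auto
    also have "\<dots> = (\<integral>\<omega>. p \<omega> * indicator a \<omega> \<partial>M)"
    proof (rule C.real_cond_exp_intg(2)[OF _ pC])
      show "integrable M (\<lambda>\<omega>. p \<omega> * indicator a \<omega>)"
        by (rule int_bounded[OF int_p]) (auto split: split_indicator)
    qed simp
    finally have eq: "(\<integral>\<omega>. indicator (a \<inter> b) \<omega> \<partial>M) = (\<integral>\<omega>. p \<omega> * indicator a \<omega> \<partial>M)" .
    have "(\<integral>\<omega>\<in>a. g \<omega> \<partial>M) = (\<integral>\<omega>. indicator (a \<inter> b) \<omega> - p \<omega> * indicator a \<omega> \<partial>M)"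
      unfolding set_lebesgue_integral_def g_def
      by (intro Bochner_Integration.integral_cong) (auto split: split_indicator)
    also have "\<dots> = (\<integral>\<omega>. indicator (a \<inter> b) \<omega> \<partial>M) - (\<integral>\<omega>. p \<omega> * indicator a \<omega> \<partial>M)"
    proof (rule Bochner_Integration.integral_diff)
      show "integrable M (\<lambda>\<omega>. p \<omega> * indicator a \<omega>)"
        by (rule int_bounded[OF int_p]) (auto split: split_indicator)
      show "integrable M (indicator (a \<inter> b) :: 'a \<Rightarrow> real)" by (rule int_ind) simp
    qed
    finally show "(\<integral>\<omega>\<in>a. g \<omega> \<partial>M) = (\<integral>\<omega>\<in>a. 0 \<partial>M)" using eq by (simp add: set_lebesgue_integral_def)
  qed (use int_g in auto)
  then have "(\<integral>\<omega>. f \<omega> * real_cond_exp M F g \<omega> \<partial>M) = 0"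
    by (intro integral_eq_zero_AE) (auto elim!: eventually_mono)
  moreover have "(\<integral>\<omega>. f \<omega> * real_cond_exp M F g \<omega> \<partial>M) = (\<integral>\<omega>. f \<omega> * g \<omega> \<partial>M)"
    by (rule F.real_cond_exp_intg(2)[OF int_bounded[OF F(4) _ g1] F(3)]) auto
  ultimately have "(\<integral>\<omega>. f \<omega> * g \<omega> \<partial>M) = 0" by simp
  moreover have int_fp: "integrable M (\<lambda>\<omega>. f \<omega> * p \<omega>)" by (rule int_bounded[OF F(4) _ p1]) simp
  moreover have int_fb: "integrable M (\<lambda>\<omega>. f \<omega> * indicator b \<omega>)"
    by (rule int_bounded[OF F(4)]) (auto split: split_indicator)
  ultimately have "(\<integral>\<omega>. f \<omega> * indicator b \<omega> \<partial>M) = (\<integral>\<omega>. f \<omega> * p \<omega> \<partial>M)"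
    by (simp add: g_def right_diff_distrib)
  also have "\<dots> = (\<integral>\<omega>. p \<omega> * f \<omega> \<partial>M)" by (simp add: mult.commute)
  also have "\<dots> = (\<integral>\<omega>. p \<omega> * real_cond_exp M ?C f \<omega> \<partial>M)"
    using int_fp by (intro C.real_cond_exp_intg(2)[OF _ pC, symmetric]) (auto simp: mult.commute)
  also have "\<dots> = (\<integral>\<omega>. real_cond_exp M ?C f \<omega> * p \<omega> \<partial>M)" by (simp add: mult.commute)
  also have "\<dots> = (\<integral>\<omega>. real_cond_exp M ?C f \<omega> * indicator b \<omega> \<partial>M)"
    unfolding p_def
  proof (rule C.real_cond_exp_intg(2))
    show "integrable M (\<lambda>\<omega>. real_cond_exp M ?C f \<omega> * indicator b \<omega>)"
      by (rule int_bounded[OF C.real_cond_exp_int(1)[OF F(4)]]) (auto split: split_indicator)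
  qed auto
  finally show ?thesis by (simp add: set_lebesgue_integral_def mult.commute)
qed

context square_integrable_gaussian_field
begin

abbreviation sub_sigma :: "'a set \<Rightarrow> 'w measure" where
  "sub_sigma S \<equiv> sigma (space M) (field_sigma M u S)"

lemma sets_sub_sigma: "sets (sub_sigma S) = field_sigma M u S"
proof -
  let ?E = "{u s -` B \<inter> space M | s B. s \<in> S \<and> B \<in> sets borel}"
  have E: "?E \<subseteq> Pow (space M)" by auto
  then have "sigma_sets (space M) ?E \<subseteq> Pow (space M)"
    using sigma_sets_into_sp[OF E] by blast
  then show ?thesis
    unfolding field_sigma_def using sigma_sets_sigma_sets_eq[OF E] by (simp add: sets_measure_of)
qed

lemma field_sigma_mono: "S \<subseteq> S' \<Longrightarrow> field_sigma M u S \<subseteq> field_sigma M u S'"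
  unfolding field_sigma_def by (intro sigma_sets_mono') auto

lemma subalgebra_sub_sigma:
  assumes "S \<subseteq> T" shows "subalgebra M (sub_sigma S)"
proof -
  have "field_sigma M u S \<subseteq> sets M"
    unfolding field_sigma_def using assms measurable_field
    by (intro sets.sigma_sets_subset) (auto intro: measurable_sets)
  then show ?thesis by (simp add: subalgebra_def sets_sub_sigma space_measure_of_conv)
qed

lemma measurable_sub_sigma: "s \<in> S \<Longrightarrow> u s \<in> borel_measurable (sub_sigma S)"
  by (rule measurableI) (auto simp: sets_sub_sigma space_measure_of_conv,
      auto simp: field_sigma_def)

lemma measurable_sub_sigma_mono:
  "f \<in> borel_measurable (sub_sigma S) \<Longrightarrow> S \<subseteq> S' \<Longrightarrow> f \<in> borel_measurable (sub_sigma S')"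
  using field_sigma_mono[of S S'] unfolding measurable_def
  by (auto simp: sets_sub_sigma space_measure_of_conv)

text \<open>
  Think of \<open>N\<close> as the complement of an open set around \<open>s\<close> with boundary \<open>B\<close>. Given the field on
  \<open>N\<close>, the only part of \<open>X\<close> that is not yet determined is the multiple of \<open>u s\<close>, and the splitting
  property replaces it by a function \<open>h\<close> of the field on \<open>B\<close>. So the conditional expectation \<open>Y\<close> of the centred
  \<open>X\<close> given the field on \<open>N\<close> is already a function of the field on \<open>I = B \<union> (P - {s})\<close>. By the
  tower property it is then the conditional expectation given the field on \<open>I\<close>, which is zero because
  \<open>X\<close> is uncorrelated with this field.
\<close>

lemma covariance_zero_beyond_splitting_set:
  fixes v :: "'a \<Rightarrow> real"
  assumes splits: "splits M (field_sigma M u B) A C"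
    and A: "field_sigma M u {s} \<subseteq> A" and C: "field_sigma M u N \<subseteq> C"
    and BN: "B \<subseteq> N" "N \<subseteq> T"
    and P: "finite P" "P \<subseteq> T" "s \<in> P" "P - {s} \<subseteq> N"
  defines "X \<equiv> \<lambda>\<omega>. \<Sum>y\<in>P. v y * u y \<omega>"
  assumes uncorrelated: "\<And>z. z \<in> B \<union> (P - {s}) \<Longrightarrow> covariance M X (u z) = 0"
    and t: "t \<in> N"
  shows "covariance M X (u t) = 0"
proof -
  define h where "h = real_cond_exp M (sub_sigma B) (u s)"
  define I where "I = B \<union> (P - {s})"
  have sub: "B \<subseteq> T" "I \<subseteq> T" "I \<subseteq> N" "s \<in> T" using P BN by (auto simp: I_def)
  interpret B: finite_measure_subalgebra M "sub_sigma B"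
    by unfold_locales (intro subalgebra_sub_sigma sub)
  interpret I: finite_measure_subalgebra M "sub_sigma I"
    by unfold_locales (intro subalgebra_sub_sigma sub)
  interpret N: finite_measure_subalgebra M "sub_sigma N"
    by unfold_locales (intro subalgebra_sub_sigma BN)
  have X: "X \<in> borel_measurable M" "integrable M X" "integrable M (\<lambda>\<omega>. (X \<omega>)\<^sup>2)"
    using linear_combination[OF P(1,2), of v] by (simp_all add: X_def)
  define X' where "X' \<omega> = X \<omega> - expectation X" for \<omega>
  define Y where "Y \<omega> = v s * h \<omega> + (\<Sum>y\<in>P - {s}. v y * u y \<omega>) - expectation X" for \<omega>
  have X': "integrable M X'" using X by (simp add: X'_def[abs_def])
  have h: "integrable M h" "h \<in> borel_measurable (sub_sigma B)"
    using B.real_cond_exp_int(1)[OF integrable_field[OF sub(4)]] by (auto simp: h_def)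
  have Y: "integrable M Y"
  proof -
    have "integrable M (\<lambda>\<omega>. \<Sum>y\<in>P - {s}. v y * u y \<omega>)"
      using P by (intro linear_combination(2)) auto
    then show ?thesis unfolding Y_def using h(1) by simp
  qed
  have "(\<lambda>\<omega>. \<Sum>y\<in>P - {s}. v y * u y \<omega>) \<in> borel_measurable (sub_sigma I)"
    by (intro borel_measurable_sum borel_measurable_times borel_measurable_const measurable_sub_sigma)
       (auto simp: I_def)
  then have Y_I: "Y \<in> borel_measurable (sub_sigma I)"
    unfolding Y_def using measurable_sub_sigma_mono[OF h(2), of I] by (auto simp: I_def)
  have diff: "X' \<omega> - Y \<omega> = v s * (u s \<omega> - h \<omega>)" for \<omega>
    using P by (simp add: X'_def X_def Y_def sum.remove[of P s] algebra_simps)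
  have XN: "AE \<omega> in M. real_cond_exp M (sub_sigma N) X' \<omega> = Y \<omega>"
  proof (rule N.real_cond_exp_charact)
    fix b assume b: "b \<in> sets (sub_sigma N)"
    then have bM: "b \<in> sets M" and bC: "b \<in> C"
      using C N.subalg by (auto simp: subalgebra_def sets_sub_sigma)
    have eq: "(\<integral>\<omega>\<in>b. u s \<omega> \<partial>M) = (\<integral>\<omega>\<in>b. h \<omega> \<partial>M)"
      unfolding h_def
    proof (rule splits_imp_set_integral_cond_exp[OF _ splits _ _ _ _ bC bM])
      show "subalgebra M (sub_sigma B)" by (rule B.subalg)
      show "subalgebra M (sub_sigma {s})" using sub by (intro subalgebra_sub_sigma) auto
    qed (use A sub integrable_field measurable_sub_sigma in \<open>auto simp: sets_sub_sigma\<close>)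
    have int: "integrable M (\<lambda>\<omega>. indicator b \<omega> * f \<omega>)" if "integrable M f" for f :: "'w \<Rightarrow> real"
      using integrable_mult_indicator[OF bM that] by simp
    have "(\<integral>\<omega>\<in>b. X' \<omega> \<partial>M) - (\<integral>\<omega>\<in>b. Y \<omega> \<partial>M) = (\<integral>\<omega>. indicator b \<omega> * X' \<omega> - indicator b \<omega> * Y \<omega> \<partial>M)"
      unfolding set_lebesgue_integral_def using int[OF X'] int[OF Y] by simp
    also have "\<dots> = (\<integral>\<omega>. v s * (indicator b \<omega> * u s \<omega> - indicator b \<omega> * h \<omega>) \<partial>M)"
      unfolding right_diff_distrib[symmetric] diff by (simp add: mult_ac)
    also have "\<dots> = 0"
      using int[OF h(1)] int[OF integrable_field[OF sub(4)]] eq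
      by (simp add: set_lebesgue_integral_def)
    finally show "(\<integral>\<omega>\<in>b. X' \<omega> \<partial>M) = (\<integral>\<omega>\<in>b. Y \<omega> \<partial>M)" by simp
  qed (use X' Y measurable_sub_sigma_mono[OF Y_I sub(3)] in auto)
  have "AE \<omega> in M. real_cond_exp M (sub_sigma I) X' \<omega> = 0"
  proof (rule I.real_cond_exp_charact)
    fix E assume "E \<in> sets (sub_sigma I)"
    then show "(\<integral>\<omega>\<in>E. X' \<omega> \<partial>M) = (\<integral>\<omega>\<in>E. 0 \<partial>M)"
      using uncorrelated_imp_set_integral_zero[OF P(1,2) sub(2), of v E] uncorrelated
      by (simp add: sets_sub_sigma X_def X'_def I_def set_lebesgue_integral_def)
  qed (use X' in auto)
  moreover have "AE \<omega> in M. real_cond_exp M (sub_sigma I) (real_cond_exp M (sub_sigma N) X') \<omega> =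
      real_cond_exp M (sub_sigma I) X' \<omega>"
    using field_sigma_mono[OF sub(3)]
    by (intro I.real_cond_exp_nested_subalg[OF N.subalg _ X'])
       (auto simp: subalgebra_def sets_sub_sigma space_measure_of_conv)
  moreover have "AE \<omega> in M. real_cond_exp M (sub_sigma I) (real_cond_exp M (sub_sigma N) X') \<omega> =
      real_cond_exp M (sub_sigma I) Y \<omega>"
    using XN Y by (intro I.real_cond_exp_cong) auto
  moreover have "AE \<omega> in M. real_cond_exp M (sub_sigma I) Y \<omega> = Y \<omega>"
    by (rule I.real_cond_exp_F_meas[OF Y Y_I])
  ultimately have "AE \<omega> in M. real_cond_exp M (sub_sigma N) X' \<omega> = 0"
    using XN by eventually_elim simp
  then have 0: "(\<integral>\<omega>. u t \<omega> * real_cond_exp M (sub_sigma N) X' \<omega> \<partial>M) = 0"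
    by (intro integral_eq_zero_AE) (auto elim!: eventually_mono)
  have tT: "t \<in> T" using t BN by auto
  have "integrable M (\<lambda>\<omega>. u t \<omega> * X \<omega>)"
    using tT X by (intro integrable_mult_of_squares measurable_field square_integrable) auto
  then have int: "integrable M (\<lambda>\<omega>. u t \<omega> * X' \<omega>)"
    using integrable_field[OF tT] by (simp add: X'_def right_diff_distrib)
  have "(\<integral>\<omega>. u t \<omega> * X' \<omega> \<partial>M) = 0"
    using N.real_cond_exp_intg(2)[OF int measurable_sub_sigma[OF t]] X' 0 by simp
  moreover have "(\<integral>\<omega>. X' \<omega> \<partial>M) = 0" using X by (simp add: X'_def prob_space)
  moreover have "covariance M X (u t) = (\<integral>\<omega>. u t \<omega> * X' \<omega> - expectation (u t) * X' \<omega> \<partial>M)"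
    unfolding covariance_def X'_def
    by (intro Bochner_Integration.integral_cong) (auto simp: algebra_simps)
  ultimately show ?thesis using int X' by simp
qed

end


section \<open>Inverses of positive definite matrices\<close>

lemma strictly_pos_def_on_subset:
  "strictly_pos_def_on S A \<Longrightarrow> S' \<subseteq> S \<Longrightarrow> strictly_pos_def_on S' A"
  unfolding strictly_pos_def_on_def by (meson subset_trans subsetD)

lemma strictly_pos_def_onD:
  assumes "strictly_pos_def_on S A" "finite S" "s \<in> S" "c s \<noteq> 0"
  shows "0 < (\<Sum>s\<in>S. \<Sum>t\<in>S. c s * A s t * c t)"
  using assms unfolding strictly_pos_def_on_def by blast

text \<open>
  Induction on the index set. With the solution \<open>\<beta>\<close> for the column of the new index \<open>y\<close>, the vector
  \<open>v\<close> that is \<open>1\<close> in \<open>y\<close> and \<open>- \<beta>\<close> elsewhere is mapped to a multiple \<open>\<kappa>\<close> of the unit vector of \<open>y\<close>.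
  Here \<open>\<kappa>\<close> is the value of the quadratic form in \<open>v\<close>, hence positive, and a multiple of \<open>v\<close> corrects
  the equation of \<open>y\<close> without disturbing the others.
\<close>

lemma strictly_pos_def_solve:
  fixes A :: "'a \<Rightarrow> 'a \<Rightarrow> real"
  assumes "finite S" "strictly_pos_def_on S A"
  shows "\<exists>x. \<forall>s\<in>S. (\<Sum>k\<in>S. A s k * x k) = b s"
  using assms
proof (induction S arbitrary: b rule: finite_induct)
  case empty
  then show ?case by simp
next
  case (insert y S)
  have "strictly_pos_def_on S A" using insert.prems by (rule strictly_pos_def_on_subset) auto
  note IH = insert.IH[OF this]
  from IH[of "\<lambda>s. A s y"] obtain \<beta> where \<beta>: "\<And>s. s \<in> S \<Longrightarrow> (\<Sum>k\<in>S. A s k * \<beta> k) = A s y" by auto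
  from IH[of b] obtain x where x: "\<And>s. s \<in> S \<Longrightarrow> (\<Sum>k\<in>S. A s k * x k) = b s" by auto
  define v where "v k = (if k = y then 1 else - \<beta> k)" for k
  have v_sum: "(\<Sum>k\<in>S. f k * v k) = - (\<Sum>k\<in>S. f k * \<beta> k)" for f
    unfolding sum_negf[symmetric] using insert.hyps by (intro sum.cong) (auto simp: v_def)
  have v: "(\<Sum>k\<in>insert y S. A s k * v k) = 0" if "s \<in> S" for s
    using insert.hyps \<beta>[OF that] v_sum[of "A s"] by (simp add: v_def)
  define \<kappa> where "\<kappa> = (\<Sum>k\<in>insert y S. A y k * v k)"
  have "0 < (\<Sum>s\<in>insert y S. \<Sum>k\<in>insert y S. v s * A s k * v k)"
    using insert.prems insert.hyps by (intro strictly_pos_def_onD[where s = y]) (auto simp: v_def)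
  also have "\<dots> = (\<Sum>s\<in>insert y S. v s * (\<Sum>k\<in>insert y S. A s k * v k))"
    by (simp add: sum_distrib_left mult.assoc)
  also have "\<dots> = \<kappa>"
    using insert.hyps v unfolding \<kappa>_def by (subst sum.insert) (auto simp: v_def)
  finally have "\<kappa> > 0" .
  define x0 where "x0 k = (if k = y then 0 else x k)" for k
  define \<mu> where "\<mu> = (b y - (\<Sum>k\<in>insert y S. A y k * x0 k)) / \<kappa>"
  have x0: "(\<Sum>k\<in>insert y S. A s k * x0 k) = b s" if "s \<in> S" for s
  proof -
    have "(\<Sum>k\<in>S. A s k * x0 k) = (\<Sum>k\<in>S. A s k * x k)"
      using insert.hyps by (intro sum.cong) (auto simp: x0_def)
    then show ?thesis using insert.hyps x[OF that] by (simp add: x0_def)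
  qed
  have "(\<Sum>k\<in>insert y S. A s k * (x0 k + \<mu> * v k)) =
      (\<Sum>k\<in>insert y S. A s k * x0 k) + \<mu> * (\<Sum>k\<in>insert y S. A s k * v k)" for s
    unfolding sum_distrib_left sum.distrib[symmetric] by (intro sum.cong) (auto simp: algebra_simps)
  moreover have "\<mu> * \<kappa> = b y - (\<Sum>k\<in>insert y S. A y k * x0 k)"
    using \<open>\<kappa> > 0\<close> by (simp add: \<mu>_def)
  ultimately have "\<forall>s\<in>insert y S. (\<Sum>k\<in>insert y S. A s k * (x0 k + \<mu> * v k)) = b s"
    using x0 v by (auto simp: \<kappa>_def[symmetric])
  then show ?case by (intro exI[of _ "\<lambda>k. x0 k + \<mu> * v k"])
qed

lemma strictly_pos_def_inverse:
  fixes A :: "'a \<Rightarrow> 'a \<Rightarrow> real"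
  assumes S: "finite S" and A: "strictly_pos_def_on S A"
  obtains Q where "inverse_matrix_on S A Q"
    and "\<And>s t. s \<in> S \<Longrightarrow> t \<in> S \<Longrightarrow> Q s t = Q t s"
    and "\<And>s. s \<in> S \<Longrightarrow> 0 < Q s s"
proof -
  have "\<forall>t. \<exists>x. \<forall>s\<in>S. (\<Sum>k\<in>S. A s k * x k) = (if s = t then 1 else 0)"
    by (intro allI strictly_pos_def_solve[OF S A])
  then obtain q where q: "\<And>s t. s \<in> S \<Longrightarrow> (\<Sum>k\<in>S. A s k * q t k) = (if s = t then 1 else 0)"
    by metis
  define Q where "Q k t = q t k" for k t
  have AQ: "(\<Sum>k\<in>S. A s k * Q k t) = (if s = t then 1 else 0)" if "s \<in> S" for s t
    using q[OF that] by (simp add: Q_def)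
  have A_sym: "A s t = A t s" if "s \<in> S" "t \<in> S" for s t
    using A that by (simp add: strictly_pos_def_on_def)
  have QAQ: "(\<Sum>k\<in>S. \<Sum>l\<in>S. Q k s * A k l * Q l t) = Q t s" if "t \<in> S" for s t
  proof -
    have "(\<Sum>k\<in>S. \<Sum>l\<in>S. Q k s * A k l * Q l t) = (\<Sum>k\<in>S. Q k s * (\<Sum>l\<in>S. A k l * Q l t))"
      by (simp add: sum_distrib_left mult.assoc)
    also have "\<dots> = (\<Sum>k\<in>S. if k = t then Q k s else 0)"
      by (intro sum.cong refl) (simp add: AQ)
    also have "\<dots> = Q t s" using S that by simp
    finally show ?thesis .
  qed
  have Q_sym: "Q s t = Q t s" if st: "s \<in> S" "t \<in> S" for s t
  proof -
    have "Q s t = (\<Sum>k\<in>S. \<Sum>l\<in>S. Q k t * A k l * Q l s)" using QAQ[OF st(1)] by simp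
    also have "\<dots> = (\<Sum>l\<in>S. \<Sum>k\<in>S. Q k t * A k l * Q l s)" by (rule sum.swap)
    also have "\<dots> = (\<Sum>l\<in>S. \<Sum>k\<in>S. Q l s * A l k * Q k t)"
      by (intro sum.cong refl) (simp add: A_sym mult_ac)
    also have "\<dots> = Q t s" by (rule QAQ[OF st(2)])
    finally show ?thesis .
  qed
  have "(\<Sum>k\<in>S. Q s k * A k t) = (if s = t then 1 else 0)" if st: "s \<in> S" "t \<in> S" for s t
  proof -
    have "(\<Sum>k\<in>S. Q s k * A k t) = (\<Sum>k\<in>S. A t k * Q k s)"
      using st by (intro sum.cong refl) (simp add: A_sym Q_sym mult.commute)
    then show ?thesis using AQ[OF st(2)] by simp
  qed
  then have inv: "inverse_matrix_on S A Q" using AQ by (simp add: inverse_matrix_on_def)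
  have pos: "0 < Q s s" if s: "s \<in> S" for s
  proof -
    obtain k where "k \<in> S" "Q k s \<noteq> 0"
    proof (rule ccontr)
      assume "\<not> thesis"
      with that have "(\<Sum>k\<in>S. A s k * Q k s) = 0" by (intro sum.neutral) auto
      with AQ[OF s] show False by simp
    qed
    then have "0 < (\<Sum>k\<in>S. \<Sum>l\<in>S. Q k s * A k l * Q l s)"
      using A S by (intro strictly_pos_def_onD)
    then show ?thesis using QAQ[OF s] by simp
  qed
  show thesis using that[OF inv Q_sym pos] .
qed


section \<open>The geodesic metric\<close>

text \<open>
  Walks are paths without the requirement that a segment ends in a vertex before the next one starts.
  In contrast to \<^const>\<open>graph_path\<close> they can be concatenated inside of an edge as well, which makes
  the triangle inequality evident. The real number is the length of the walk.
\<close>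

inductive walk :: "('a, 'e) metric_graph \<Rightarrow> 'a \<Rightarrow> real \<Rightarrow> 'a \<Rightarrow> bool" for G where
  walk_refl: "x \<in> points G \<Longrightarrow> walk G x 0 x"
| walk_step: "e \<in> edges G \<Longrightarrow> a \<in> {0..len G e} \<Longrightarrow> b \<in> {0..len G e} \<Longrightarrow>
    walk G (pt G e b) l y \<Longrightarrow> walk G (pt G e a) (\<bar>a - b\<bar> + l) y"

lemma pt_in_points: "e \<in> edges G \<Longrightarrow> a \<in> {0..len G e} \<Longrightarrow> pt G e a \<in> points G"
  unfolding points_def edge_points_def by blast

lemma walk_in_points:
  assumes "walk G x l y" shows "x \<in> points G" and "y \<in> points G"
  using assms by (induction rule: walk.induct) (auto intro: pt_in_points)

lemma walk_trans: "walk G x l y \<Longrightarrow> walk G y k z \<Longrightarrow> walk G x (l + k) z"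
proof (induction rule: walk.induct)
  case (walk_step e a b l y)
  then have "walk G (pt G e a) (\<bar>a - b\<bar> + (l + k)) z"
    by (intro walk.walk_step) auto
  then show ?case by (simp add: add.assoc)
qed auto

lemma walk_sym: "walk G x l y \<Longrightarrow> walk G y l x"
proof (induction rule: walk.induct)
  case (walk_step e a b l y)
  have "walk G (pt G e b) (\<bar>b - a\<bar> + 0) (pt G e a)"
    using walk_step by (intro walk.walk_step walk.walk_refl pt_in_points) auto
  from walk_trans[OF walk_step.IH this] show ?case by (simp add: abs_minus_commute add.commute)
qed (auto intro: walk.walk_refl)

definition valid_segment :: "('a, 'e) metric_graph \<Rightarrow> 'e segment \<Rightarrow> bool" where
  "valid_segment G f \<longleftrightarrow> seg_edge f \<in> edges G \<and>
     seg_from f \<in> {0..len G (seg_edge f)} \<and> seg_to f \<in> {0..len G (seg_edge f)}"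

lemma graph_path_Nil: "graph_path G s [] t \<longleftrightarrow> s \<in> points G \<and> s = t"
  by (auto simp: graph_path_def)

lemma valid_segment_end_in_points: "valid_segment G f \<Longrightarrow> seg_end G f \<in> points G"
  and valid_segment_start_in_points: "valid_segment G f \<Longrightarrow> seg_start G f \<in> points G"
  by (auto simp: valid_segment_def seg_end_def seg_start_def intro!: pt_in_points)

text \<open>
  Turns the conditions on the positions in the list of segments into a recursion. The last conjunct
  concerns the second segment because it becomes the first one of the remaining path, where it may be
  degenerate.
\<close>

lemma graph_path_Cons:
  "graph_path G s (f # fs) t \<longleftrightarrow>
     valid_segment G f \<and> s = seg_start G f \<and> graph_path G (seg_end G f) fs t \<and>
     (fs \<noteq> [] \<longrightarrow> seg_to f \<in> {0, len G (seg_edge f)} \<and>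
        seg_from (hd fs) \<in> {0, len G (seg_edge (hd fs))}) \<and>
     (tl fs \<noteq> [] \<longrightarrow> seg_from (hd fs) \<noteq> seg_to (hd fs))" (is "?L \<longleftrightarrow> ?R")
proof
  assume L: ?L
  show ?R
  proof (cases fs)
    case Nil
    with L show ?thesis
      by (auto simp: graph_path_def valid_segment_def seg_start_def seg_end_def)
  next
    case (Cons g gs)
    have L0: "\<And>i. Suc i < length (f # fs) \<Longrightarrow>
        seg_to ((f # fs) ! i) \<in> {0, len G (seg_edge ((f # fs) ! i))} \<and>
        seg_from ((f # fs) ! Suc i) \<in> {0, len G (seg_edge ((f # fs) ! Suc i))} \<and>
        seg_end G ((f # fs) ! i) = seg_start G ((f # fs) ! Suc i)"
      and L1: "\<And>i. 0 < i \<Longrightarrow> Suc i < length (f # fs) \<Longrightarrow> seg_from ((f # fs) ! i) \<noteq> seg_to ((f # fs) ! i)"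
      and L2: "valid_segment G f" "s = seg_start G f" "seg_end G (last fs) = t" "t \<in> points G"
        "\<forall>f\<in>set fs. valid_segment G f"
      using L Cons by (auto simp: graph_path_def valid_segment_def)
    have "graph_path G (seg_end G f) fs t"
      unfolding graph_path_def
    proof (intro conjI allI impI)
      show "seg_end G f \<in> points G" by (rule valid_segment_end_in_points[OF L2(1)])
      fix i assume i: "Suc i < length fs"
      then show "seg_to (fs ! i) \<in> {0, len G (seg_edge (fs ! i))}"
        "seg_from (fs ! Suc i) \<in> {0, len G (seg_edge (fs ! Suc i))}"
        "seg_end G (fs ! i) = seg_start G (fs ! Suc i)"
        using L0[of "Suc i"] by auto
    next
      fix i assume i: "0 < i \<and> Suc i < length fs"
      then show "seg_from (fs ! i) \<noteq> seg_to (fs ! i)" using L1[of "Suc i"] by auto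
    qed (use L2 Cons L0[of 0] in \<open>auto simp: valid_segment_def\<close>)
    then show ?thesis using L2 L0[of 0] L1[of 1] Cons by (auto simp: neq_Nil_conv)
  qed
next
  assume R: ?R
  show ?L
  proof (cases fs)
    case Nil
    with R show ?thesis
      by (auto simp: graph_path_def valid_segment_def valid_segment_start_in_points)
  next
    case (Cons g gs)
    show ?thesis
      unfolding graph_path_def
    proof (intro conjI allI impI)
      show "s \<in> points G" using R valid_segment_start_in_points by auto
      fix i assume i: "Suc i < length (f # fs)"
      show "seg_to ((f # fs) ! i) \<in> {0, len G (seg_edge ((f # fs) ! i))}"
        "seg_from ((f # fs) ! Suc i) \<in> {0, len G (seg_edge ((f # fs) ! Suc i))}"
        "seg_end G ((f # fs) ! i) = seg_start G ((f # fs) ! Suc i)"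
        using R i Cons by (cases i; auto simp: graph_path_def)+
    next
      fix i assume i: "0 < i \<and> Suc i < length (f # fs)"
      then show "seg_from ((f # fs) ! i) \<noteq> seg_to ((f # fs) ! i)"
      proof (cases "i = 1")
        case True
        with i Cons have "tl fs \<noteq> []" by auto
        then show ?thesis using R True Cons by auto
      next
        case False
        then obtain j where "i = Suc j" "0 < j" using i by (cases i) auto
        then show ?thesis using R i by (auto simp: graph_path_def)
      qed
    qed (use R Cons in \<open>auto simp: graph_path_def valid_segment_def\<close>)
  qed
qed

lemma graph_path_imp_walk: "graph_path G s fs t \<Longrightarrow> walk G s (path_length fs) t"
proof (induction fs arbitrary: s)
  case Nil
  then show ?case by (auto simp: graph_path_Nil path_length_def intro: walk_refl)
next
  case (Cons f fs)
  then have "walk G (seg_end G f) (path_length fs) t" by (auto simp: graph_path_Cons)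
  then have "walk G (pt G (seg_edge f) (seg_from f)) (\<bar>seg_from f - seg_to f\<bar> + path_length fs) t"
    using Cons.prems by (intro walk_step) (auto simp: graph_path_Cons seg_end_def valid_segment_def)
  then show ?case
    using Cons.prems by (auto simp: graph_path_Cons seg_start_def path_length_def abs_minus_commute)
qed

context compact_metric_graph
begin

lemma pt_in_verts_iff:
  "e \<in> edges G \<Longrightarrow> a \<in> {0..len G e} \<Longrightarrow> pt G e a \<in> verts G \<longleftrightarrow> a \<in> {0, len G e}"
  using start_in_verts end_in_verts inner_notin_verts[of e a] by force

text \<open>
  A segment can be put in front of a path even if they meet inside of an edge. Then both run in the
  same edge and are merged into one segment, which is not longer than the two together. If they meet
  in a vertex, the segment is just added, unless the path starts with a degenerate segment; that one
  is removed first.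
\<close>

lemma graph_path_prepend:
  assumes "graph_path G x gs t" "valid_segment G f" "seg_end G f = x"
  shows "\<exists>hs. graph_path G (seg_start G f) hs t \<and>
    path_length hs \<le> \<bar>seg_to f - seg_from f\<bar> + path_length gs"
  using assms
proof (induction gs arbitrary: x)
  case Nil
  then have "graph_path G (seg_start G f) [f] t"
    by (auto simp: graph_path_Cons graph_path_Nil)
  then show ?case by (intro exI[of _ "[f]"]) (auto simp: path_length_def)
next
  case (Cons g gs)
  note g = Cons.prems(1)[unfolded graph_path_Cons]
  have x: "pt G (seg_edge f) (seg_to f) = x" "pt G (seg_edge g) (seg_from g) = x"
    using g Cons.prems by (auto simp: seg_end_def seg_start_def)
  have xv: "x \<in> verts G \<longleftrightarrow> seg_to f \<in> {0, len G (seg_edge f)}"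
    "x \<in> verts G \<longleftrightarrow> seg_from g \<in> {0, len G (seg_edge g)}"
    using x g Cons.prems(2) pt_in_verts_iff[of "seg_edge f" "seg_to f"]
      pt_in_verts_iff[of "seg_edge g" "seg_from g"] by (auto simp: valid_segment_def)
  consider (degenerate) "seg_from g = seg_to g" | (vertex) "seg_from g \<noteq> seg_to g" "x \<in> verts G"
    | (inner) "seg_from g \<noteq> seg_to g" "x \<notin> verts G" by blast
  then show ?case
  proof cases
    case degenerate
    then have "graph_path G x gs t" using g x by (auto simp: seg_end_def)
    from Cons.IH[OF this Cons.prems(2,3)] degenerate show ?thesis
      by (auto simp: path_length_def)
  next
    case vertex
    then have "graph_path G (seg_start G f) (f # g # gs) t"
      using Cons.prems xv by (auto simp: graph_path_Cons[of G _ f])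
    then show ?thesis by (intro exI[of _ "f # g # gs"]) (auto simp: path_length_def)
  next
    case inner
    have eq: "seg_edge f = seg_edge g" "seg_to f = seg_from g"
      using inner_inj[of "seg_edge f" "seg_to f" "seg_edge g" "seg_from g"] x xv inner g
        Cons.prems(2) by (auto simp: valid_segment_def)
    let ?h = "Seg (seg_edge g) (seg_from f) (seg_to g)"
    have "graph_path G (seg_start G f) (?h # gs) t"
      using g eq Cons.prems(2)
      by (auto simp: graph_path_Cons seg_start_def seg_end_def valid_segment_def)
    moreover have "path_length (?h # gs) \<le> \<bar>seg_to f - seg_from f\<bar> + path_length (g # gs)"
      using eq by (auto simp: path_length_def)
    ultimately show ?thesis by blast
  qed
qed

lemma walk_imp_graph_path:
  "walk G x l y \<Longrightarrow> \<exists>fs. graph_path G x fs y \<and> path_length fs \<le> l"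
proof (induction rule: walk.induct)
  case (walk_refl x)
  then show ?case by (intro exI[of _ "[]"]) (auto simp: graph_path_Nil path_length_def)
next
  case (walk_step e a b l y)
  then obtain fs where "graph_path G (pt G e b) fs y" "path_length fs \<le> l" by blast
  with graph_path_prepend[of "pt G e b" fs y "Seg e a b"] walk_step.hyps show ?case
    by (fastforce simp: valid_segment_def seg_start_def seg_end_def abs_minus_commute)
qed

text \<open>
  The values on the edges need to agree in the vertices only, because a point inside of an edge belongs
  to no other edge and has a unique parameter there.
\<close>

lemma lipschitz_extension:
  assumes ends: "\<And>e. e \<in> edges G \<Longrightarrow> g e 0 = \<phi> (pt G e 0) \<and> g e (len G e) = \<phi> (pt G e (len G e))"
    and lip: "\<And>e a b. e \<in> edges G \<Longrightarrow> a \<in> {0..len G e} \<Longrightarrow> b \<in> {0..len G e} \<Longrightarrow>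
      \<bar>g e a - g e b\<bar> \<le> \<bar>a - b\<bar>"
  obtains F :: "'a \<Rightarrow> real"
  where "\<And>v. v \<in> verts G \<Longrightarrow> F v = \<phi> v"
    and "\<And>e a. e \<in> edges G \<Longrightarrow> a \<in> {0..len G e} \<Longrightarrow> F (pt G e a) = g e a"
    and "\<And>x l y. walk G x l y \<Longrightarrow> \<bar>F x - F y\<bar> \<le> l"
proof
  define F where "F p = (if p \<in> verts G then \<phi> p else
    (THE x. \<exists>e\<in>edges G. \<exists>a. 0 < a \<and> a < len G e \<and> p = pt G e a \<and> x = g e a))" for p
  show "F v = \<phi> v" if "v \<in> verts G" for v using that by (simp add: F_def)
  show F: "F (pt G e a) = g e a" if e: "e \<in> edges G" "a \<in> {0..len G e}" for e a
  proof (cases "a \<in> {0, len G e}")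
    case True
    then show ?thesis using ends[OF e(1)] start_in_verts[OF e(1)] end_in_verts[OF e(1)]
      by (auto simp: F_def)
  next
    case False
    then have a: "0 < a" "a < len G e" using e by auto
    have "(THE x. \<exists>e'\<in>edges G. \<exists>a'. 0 < a' \<and> a' < len G e' \<and> pt G e a = pt G e' a' \<and> x = g e' a') = g e a"
    proof (rule the_equality)
      show "\<exists>e'\<in>edges G. \<exists>a'. 0 < a' \<and> a' < len G e' \<and> pt G e a = pt G e' a' \<and> g e a = g e' a'"
        using e a by blast
    qed (use inner_inj[OF e(1) a] in blast)
    then show ?thesis using inner_notin_verts[OF e(1) a] by (simp add: F_def)
  qed
  show "\<bar>F x - F y\<bar> \<le> l" if "walk G x l y" for x l y
    using that
  proof (induction rule: walk.induct)
    case (walk_step e a b l y)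
    then show ?case using lip[of e a b] F[of e a] F[of e b] by auto
  qed auto
qed

text \<open>
  Such a function bounds the length of all walks from \<open>s\<close> to \<open>t\<close> away from zero, which makes the
  geodesic distance of distinct points positive. If one of the points lies inside of an edge, a tent
  around it that stays within the edge will do. Between two vertices, the function is interpolated
  linearly from the values \<open>\<epsilon>\<close> in \<open>s\<close> and \<open>0\<close> in the other vertices.
\<close>

lemma separating_lipschitz_function:
  assumes "s \<in> points G" "t \<in> points G" "s \<noteq> t"
  obtains F :: "'a \<Rightarrow> real"
  where "F s \<noteq> F t" and "\<And>x l y. walk G x l y \<Longrightarrow> \<bar>F x - F y\<bar> \<le> l"
proof -
  have inner: "\<exists>F::'a \<Rightarrow> real. F s \<noteq> F t \<and> (\<forall>x l y. walk G x l y \<longrightarrow> \<bar>F x - F y\<bar> \<le> l)"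
    if s: "s \<in> points G" "s \<notin> verts G" and t: "t \<in> points G" "s \<noteq> t" for s t
  proof -
    obtain e0 c where e0: "e0 \<in> edges G" "c \<in> {0..len G e0}" "s = pt G e0 c"
      using s by (auto simp: points_def edge_points_def)
    with s pt_in_verts_iff have c: "0 < c" "c < len G e0" by fastforce+
    define g where "g e a = (if e = e0 then max 0 (min c (len G e0 - c) - \<bar>a - c\<bar>) else 0)" for e a
    obtain F where F: "\<And>v. v \<in> verts G \<Longrightarrow> F v = (0::real)"
      "\<And>e a. e \<in> edges G \<Longrightarrow> a \<in> {0..len G e} \<Longrightarrow> F (pt G e a) = g e a"
      "\<And>x l y. walk G x l y \<Longrightarrow> \<bar>F x - F y\<bar> \<le> l"
    proof (rule lipschitz_extension[of g "\<lambda>_. 0"])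
      show "\<bar>g e a - g e b\<bar> \<le> \<bar>a - b\<bar>" for e a b
        unfolding g_def by (simp add: max_def) linarith
    qed (use c in \<open>auto simp: g_def\<close>)
    have Fs: "F s = min c (len G e0 - c)" using F(2)[OF e0(1,2)] e0 c by (auto simp: g_def)
    have "F t < F s"
    proof (cases "t \<in> verts G")
      case True
      then show ?thesis using F(1) Fs c by auto
    next
      case False
      then obtain e a where ea: "e \<in> edges G" "a \<in> {0..len G e}" "t = pt G e a"
        using t by (auto simp: points_def edge_points_def)
      then have "e \<noteq> e0 \<or> a \<noteq> c" using e0 t by auto
      then show ?thesis using F(2)[OF ea(1,2)] ea Fs c by (auto simp: g_def)
    qed
    then show ?thesis using F(3) by (intro exI[of _ F]) auto
  qed
  consider "s \<notin> verts G" | "t \<notin> verts G" | "s \<in> verts G" "t \<in> verts G" by blast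
  then have "\<exists>F::'a \<Rightarrow> real. F s \<noteq> F t \<and> (\<forall>x l y. walk G x l y \<longrightarrow> \<bar>F x - F y\<bar> \<le> l)"
  proof cases
    case 1
    then show ?thesis using inner[of s t] assms by blast
  next
    case 2
    then show ?thesis using inner[of t s] assms by metis
  next
    case 3
    \<comment> \<open>No edge is shorter than \<open>\<epsilon>\<close>, so that the slope of the interpolation is at most 1. The
      inserted 1 serves a graph without edges.\<close>
    define \<epsilon> where "\<epsilon> = Min (insert 1 (len G ` edges G))"
    have \<epsilon>: "0 < \<epsilon>" "\<And>e. e \<in> edges G \<Longrightarrow> \<epsilon> \<le> len G e"
      using finite_edges len_pos by (auto simp: \<epsilon>_def)
    define \<phi> where "\<phi> v = (if v = s then \<epsilon> else 0)" for v
    define g where "g e a = \<phi> (pt G e 0) + a * ((\<phi> (pt G e (len G e)) - \<phi> (pt G e 0)) / len G e)" for e a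
    have lip: "\<bar>g e a - g e b\<bar> \<le> \<bar>a - b\<bar>" if "e \<in> edges G" for e a b
    proof -
      define k where "k = (\<phi> (pt G e (len G e)) - \<phi> (pt G e 0)) / len G e"
      have "\<bar>k\<bar> \<le> 1"
        using \<epsilon>(1) \<epsilon>(2)[OF that] by (auto simp: \<phi>_def k_def divide_simps)
      moreover have "g e a - g e b = (a - b) * k"
        unfolding g_def k_def[symmetric] by (simp add: algebra_simps)
      ultimately show ?thesis
        using mult_left_mono[of "\<bar>k\<bar>" 1 "\<bar>a - b\<bar>"] by (simp add: abs_mult)
    qed
    obtain F where F: "\<And>v. v \<in> verts G \<Longrightarrow> F v = \<phi> v"
      "\<And>x l y. walk G x l y \<Longrightarrow> \<bar>F x - F y\<bar> \<le> l"
    proof (rule lipschitz_extension[of g \<phi>])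
      show "g e 0 = \<phi> (pt G e 0) \<and> g e (len G e) = \<phi> (pt G e (len G e))" if "e \<in> edges G" for e
        using len_pos[OF that] by (simp add: g_def)
    qed (use lip in auto)
    have "F s \<noteq> F t" using F(1) 3 assms(3) \<epsilon>(1) by (simp add: \<phi>_def)
    with F(2) show ?thesis by blast
  qed
  with that show thesis by blast
qed

lemma walk_length_nonneg: "walk G x l y \<Longrightarrow> 0 \<le> l"
  by (induction rule: walk.induct) auto

lemma geo_dist_le_walk:
  assumes "walk G s l t" shows "geo_dist G s t \<le> l"
proof -
  obtain fs where fs: "graph_path G s fs t" "path_length fs \<le> l"
    using walk_imp_graph_path[OF assms] by blast
  have "Inf {path_length fs | fs. graph_path G s fs t} \<le> path_length fs"
    using fs(1) by (intro cInf_lower) (auto intro!: bdd_belowI[of _ 0] walk_length_nonneg graph_path_imp_walk)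
  then show ?thesis using fs(2) walk_in_points[OF assms] by (simp add: geo_dist_def)
qed

lemma geo_dist_greatest:
  assumes "connected_graph G" "s \<in> points G" "t \<in> points G" "\<And>l. walk G s l t \<Longrightarrow> k \<le> l"
  shows "k \<le> geo_dist G s t"
proof -
  obtain fs where "graph_path G s fs t"
    using assms(1-3) unfolding connected_graph_def by blast
  then have "k \<le> Inf {path_length fs | fs. graph_path G s fs t}"
    by (intro cInf_greatest) (auto intro: assms(4) graph_path_imp_walk)
  then show ?thesis using assms by (simp add: geo_dist_def)
qed

lemma geo_dist_refl: "s \<in> points G \<Longrightarrow> geo_dist G s s \<le> 0"
  by (rule geo_dist_le_walk[OF walk_refl])

theorem Metric_space_geo_dist:
  assumes "connected_graph G"
  shows "Metric_space (points G) (geo_dist G)"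
proof
  note greatest = geo_dist_greatest[OF assms]
  show nonneg: "0 \<le> geo_dist G x y" for x y
    using greatest[of x y 0] walk_length_nonneg by (auto simp: geo_dist_def)
  show "geo_dist G x y = geo_dist G y x" for x y
  proof (cases "x \<in> points G \<and> y \<in> points G")
    case True
    then show ?thesis
      by (intro antisym greatest) (auto intro: geo_dist_le_walk walk_sym)
  qed (auto simp: geo_dist_def)
  show "geo_dist G x y = 0 \<longleftrightarrow> x = y" if xy: "x \<in> points G" "y \<in> points G" for x y
  proof
    assume "x = y"
    then show "geo_dist G x y = 0" using geo_dist_refl[OF xy(1)] nonneg[of x y] by auto
  next
    assume 0: "geo_dist G x y = 0"
    show "x = y"
    proof (rule ccontr)
      assume "x \<noteq> y"
      then obtain F :: "'a \<Rightarrow> real" where F: "F x \<noteq> F y" "\<And>x l y. walk G x l y \<Longrightarrow> \<bar>F x - F y\<bar> \<le> l"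
        using separating_lipschitz_function[OF xy] by metis
      then have "\<bar>F x - F y\<bar> \<le> geo_dist G x y" by (intro greatest xy)
      with 0 F(1) show False by auto
    qed
  qed
  show "geo_dist G x z \<le> geo_dist G x y + geo_dist G y z"
    if xyz: "x \<in> points G" "y \<in> points G" "z \<in> points G" for x y z
  proof -
    have "geo_dist G x z - geo_dist G x y \<le> geo_dist G y z"
    proof (rule greatest[OF xyz(2,3)])
      fix k assume k: "walk G y k z"
      have "geo_dist G x z - k \<le> geo_dist G x y"
        using geo_dist_le_walk[OF walk_trans[OF _ k]] by (intro greatest xyz) force
      then show "geo_dist G x z - geo_dist G x y \<le> k" by simp
    qed
    then show ?thesis by simp
  qed
qed

lemma topspace_geo_topology:
  assumes "connected_graph G" shows "topspace (geo_topology G) = points G"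
  unfolding geo_topology_def by (rule Metric_space.topspace_mtopology[OF Metric_space_geo_dist[OF assms]])

end


section \<open>Sign of the precision matrix\<close>

lemma (in compact_metric_graph) field_sigma_subset_plus:
  assumes "S \<subseteq> points G"
  shows "field_sigma M u S \<subseteq> field_sigma_plus G M u S"
proof -
  have "S \<subseteq> geo_nbhd G S \<epsilon>" if "\<epsilon> > 0" for \<epsilon>
  proof
    fix s assume "s \<in> S"
    then have "s \<in> points G" using assms by auto
    then have "geo_dist G s s < \<epsilon>" using geo_dist_refl[of s] that by linarith
    with \<open>s \<in> S\<close> \<open>s \<in> points G\<close> show "s \<in> geo_nbhd G S \<epsilon>" by (auto simp: geo_nbhd_def)
  qed
  then show ?thesis
    unfolding field_sigma_plus_def field_sigma_def by (intro INT_greatest sigma_sets_mono') auto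
qed

text \<open>
  The intermediate value theorem in the form needed here: one open set separates \<open>s\<close> from \<open>t\<close> by
  zeros of \<open>c\<close>, instead of a zero on each path between them.
\<close>

lemma superlevel_set_topology:
  fixes c :: "'a \<Rightarrow> real"
  assumes "continuous_map X euclideanreal c"
  shows "openin X {x \<in> topspace X. 0 < c x}"
    and "X frontier_of {x \<in> topspace X. 0 < c x} \<subseteq> {x \<in> topspace X. c x = 0}"
proof -
  let ?S = "{x \<in> topspace X. 0 < c x}"
  show S: "openin X ?S"
    using openin_continuous_map_preimage[OF assms, of "{0<..}"] by simp
  have "closedin X {x \<in> topspace X. 0 \<le> c x}"
    using closedin_continuous_map_preimage[OF assms, of "{0..}"] by simp
  then have "X closure_of ?S \<subseteq> {x \<in> topspace X. 0 \<le> c x}"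
    by (intro closure_of_minimal) auto
  then show "X frontier_of ?S \<subseteq> {x \<in> topspace X. c x = 0}"
    using S by (auto simp: frontier_of_def interior_of_openin)
qed

theorem theorem3:
  fixes G :: "('a, 'e) metric_graph"
    and d :: "'a \<Rightarrow> 'a \<Rightarrow> real"
    and M :: "'w measure"
    and u :: "'a \<Rightarrow> 'w \<Rightarrow> real"
    and r :: "'a \<Rightarrow> 'a \<Rightarrow> real"
    and P :: "'a set"
  assumes "compact_metric_graph G" and "connected_graph G"
    and "Metric_space (points G) d"
    and "intermediate_value_property G d"
    and "regular_metric G d"
    and "connected_metric G d"
    and "prob_space M" and "complete_measure M"
    and "gaussian_field M (points G) u"
    and "markov_order_1 G M u"
    and "\<And>s t. s \<in> points G \<Longrightarrow> t \<in> points G \<Longrightarrow> r s t = covariance M (u s) (u t)"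
    and "continuous_map (prod_topology (geo_topology G) (geo_topology G)) euclideanreal
           (\<lambda>(s, t). r s t)"
    and "strictly_pos_def_on (points G) r"
    and "admissible G P"
  shows "gaussian_mtp2 M P u"
proof -
  interpret compact_metric_graph G by fact
  have L2: "L2_continuous G M u"
    and markov: "\<And>S. openin (geo_topology G) S \<Longrightarrow>
      splits M (field_sigma M u (geo_topology G frontier_of S))
        (field_sigma_plus G M u (geo_topology G closure_of S))
        (field_sigma_plus G M u (points G - S))"
    using assms(10) by (auto simp: markov_order_1_def)
  interpret square_integrable_gaussian_field M "points G" u
  proof (rule square_integrable_gaussian_field.intro[OF assms(7)], standard)
    show "gaussian_field M (points G) u" by fact
  qed (use L2 in \<open>auto simp: L2_continuous_def\<close>)
  note top = topspace_geo_topology[OF assms(2)]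
  have P: "finite P" "verts G \<subseteq> P" "P \<subseteq> points G" using assms(14) by (auto simp: admissible_def)
  have r_cov: "covariance M (u s) (u t) = r s t" if "s \<in> points G" "t \<in> points G" for s t
    using assms(11) that by simp
  have "strictly_pos_def_on P r"
    using assms(13) P(3) by (rule strictly_pos_def_on_subset)
  then obtain Q where Q: "inverse_matrix_on P r Q"
    and Q_sym: "\<And>s t. s \<in> P \<Longrightarrow> t \<in> P \<Longrightarrow> Q s t = Q t s"
    and Q_pos: "\<And>s. s \<in> P \<Longrightarrow> 0 < Q s s"
    using strictly_pos_def_inverse[OF P(1)] by blast
  have "Q s t \<le> 0" if st: "s \<in> P" "t \<in> P" "s \<noteq> t" for s t
  proof (rule ccontr)
    assume "\<not> Q s t \<le> 0"
    then have Qst: "0 < Q s t" by simp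
    \<comment> \<open>This combination of two rows of \<open>Q\<close> has no entry in \<open>t\<close>, and the covariance matrix maps it to
      \<open>Q t t\<close> in \<open>s\<close>, \<open>- Q s t\<close> in \<open>t\<close> and \<open>0\<close> elsewhere: it is the residual of \<open>u s\<close> up to a factor.\<close>
    define v where "v y = Q t t * Q s y - Q s t * Q t y" for y
    have v_t: "v t = 0" by (simp add: v_def)
    define X where "X = (\<lambda>\<omega>. \<Sum>y\<in>P - {t}. v y * u y \<omega>)"
    define c where "c q = (\<Sum>y\<in>P. v y * r y q)" for q
    have P': "finite (P - {t})" "P - {t} \<subseteq> points G" "s \<in> P - {t}" using P st by auto
    have cov: "covariance M X (u q) = c q" if "q \<in> points G" for q
    proof -
      have "covariance M X (u q) = (\<Sum>y\<in>P - {t}. v y * covariance M (u y) (u q))"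
        unfolding X_def
        by (intro covariance_linear_combination P' measurable_field square_integrable that)
      also have "\<dots> = (\<Sum>y\<in>P - {t}. v y * r y q)"
        using P' that by (intro sum.cong refl) (auto simp: r_cov)
      also have "\<dots> = c q" using P(1) st v_t by (simp add: c_def sum.remove[of P t])
      finally show ?thesis .
    qed
    have c_P: "c q = Q t t * (if s = q then 1 else 0) - Q s t * (if t = q then 1 else 0)"
      if "q \<in> P" for q
    proof -
      have "c q = Q t t * (\<Sum>y\<in>P. Q s y * r y q) - Q s t * (\<Sum>y\<in>P. Q t y * r y q)"
        unfolding c_def v_def sum_distrib_left sum_subtractf[symmetric]
        by (intro sum.cong) (auto simp: algebra_simps)
      then show ?thesis using Q st that by (simp add: inverse_matrix_on_def)
    qed
    have c_s: "0 < c s" and c_t: "c t < 0" and c_rest: "\<And>q. q \<in> P - {s, t} \<Longrightarrow> c q = 0"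
      using c_P st Qst Q_pos[OF st(2)] by auto
    have "continuous_map (geo_topology G) euclideanreal (\<lambda>q. r y q)" if "y \<in> points G" for y
    proof -
      have "continuous_map (geo_topology G) (prod_topology (geo_topology G) (geo_topology G)) (\<lambda>q. (y, q))"
        using that top by (simp add: continuous_map_pairedI)
      from continuous_map_compose[OF this assms(12)] show ?thesis by (simp add: o_def)
    qed
    then have cont: "continuous_map (geo_topology G) euclideanreal c"
      unfolding c_def[abs_def] using P
      by (intro continuous_map_sum continuous_map_real_mult) auto
    define S where "S = {q \<in> points G. 0 < c q}"
    define B where "B = geo_topology G frontier_of S"
    define N where "N = points G - S"
    have S: "openin (geo_topology G) S" and B: "B \<subseteq> {q \<in> points G. c q = 0}"
      using superlevel_set_topology[OF cont] by (auto simp: top S_def B_def)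
    have sS: "s \<in> geo_topology G closure_of S"
      using closure_of_subset[of S "geo_topology G"] top P(3) st(1) c_s by (auto simp: S_def)
    have cl: "geo_topology G closure_of S \<subseteq> points G"
      using closure_of_subset_topspace top by metis
    have "covariance M X (u t) = 0"
      unfolding X_def
    proof (rule covariance_zero_beyond_splitting_set[where s = s and N = N and B = B])
      show "splits M (field_sigma M u B) (field_sigma_plus G M u (geo_topology G closure_of S))
          (field_sigma_plus G M u N)"
        unfolding B_def N_def by (rule markov[OF S])
      have "field_sigma M u {s} \<subseteq> field_sigma M u (geo_topology G closure_of S)"
        using sS by (intro field_sigma_mono) auto
      also have "\<dots> \<subseteq> field_sigma_plus G M u (geo_topology G closure_of S)"
        by (rule field_sigma_subset_plus[OF cl])
      finally show "field_sigma M u {s} \<subseteq> field_sigma_plus G M u (geo_topology G closure_of S)" .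
      show "field_sigma M u N \<subseteq> field_sigma_plus G M u N"
        by (rule field_sigma_subset_plus) (auto simp: N_def)
      show "B \<subseteq> N" "N \<subseteq> points G" using B by (auto simp: N_def S_def)
      show "P - {t} - {s} \<subseteq> N" using P c_rest by (auto simp: N_def S_def)
      show "t \<in> N" using P st c_t by (auto simp: N_def S_def)
      show "covariance M (\<lambda>\<omega>. \<Sum>y\<in>P - {t}. v y * u y \<omega>) (u z) = 0"
        if "z \<in> B \<union> (P - {t} - {s})" for z
      proof -
        have "z \<in> points G" using that B P(3) by auto
        moreover have "c z = 0" using that B c_rest[of z] by auto
        ultimately show ?thesis using cov[unfolded X_def] by simp
      qed
    qed (use P' in auto)
    moreover have "t \<in> points G" using st(2) P(3) by auto
    ultimately show False using cov[of t] c_t by simp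
  qed
  moreover have "inverse_matrix_on P (\<lambda>s t. covariance M (u s) (u t)) Q"
  proof -
    have "(\<Sum>k\<in>P. r s k * Q k t) = (\<Sum>k\<in>P. covariance M (u s) (u k) * Q k t)"
      "(\<Sum>k\<in>P. Q s k * r k t) = (\<Sum>k\<in>P. Q s k * covariance M (u k) (u t))"
      if "s \<in> P" "t \<in> P" for s t
      using subsetD[OF P(3)] that by (simp_all add: r_cov cong: sum.cong)
    then show ?thesis using Q by (simp add: inverse_matrix_on_def)
  qed
  moreover have "gaussian_field M P u"
    using gaussian P(3) by (auto simp: gaussian_field_def)
  ultimately show ?thesis
    using P nonempty_verts Q_pos unfolding gaussian_mtp2_def by blast
qed

end
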